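(* Let $(K,d,\mu)$ be a scale-irregular Vicsek set, let $1<p<\infty$, and let $(\mathcal{E}_p,\mathcal{F}_p)$ be the $p$-energy on $K$ defined in the context. Then there exists a family of finite Borel measures $\{\Gamma_p\langle u\rangle\}_{u\in\mathcal{F}_p}$ on $K$ satisfying the following: (1) For $u\in\mathcal{F}_p$, $\Gamma_p\langle u\rangle(K)=\mathcal{E}_p(u)$. Moreover, $\Gamma_p\langle u\rangle=0$ if and only if $u$ is constant. (2) For any two $u_1,u_2\in\mathcal{F}_p$ and any non-negative Borel measurable function $g$ on $K$, $$\left(\int_Kg\,d\Gamma_p\langle u_1+u_2\rangle\right)^{1/p}\le\left(\int_Kg\,d\Gamma_p\langle u_1\rangle\right)^{1/p}+\left(\int_Kg\,d\Gamma_p\langle u_2\rangle\right)^{1/p}.$$ (3) For any $f\in C^1(\mathbb{R})$ and any $u\in\mathcal{F}_p$, $$d\Gamma_p\langle f\circ u\rangle(x)=|f'(u(x))|^p\,d\Gamma_p\langle u\rangle(x)\quad\text{for }\Gamma_p\langle u\rangle\text{-a.e. }x\in K.$$ (4) (Energy image density property) For any $u\in\mathcal{F}_p$, $u_*(\Gamma_p\langle u\rangle)\ll\mathscr{L}^1$, where $u_*(\Gamma_p\langle u\rangle)(A):=\Gamma_p\langle u\rangle(u^{-1}(A))$ for Borel $A\subset\mathbb{R}$ and $\mathscr{L}^1$ is the Lebesgue measure on $\mathbb{R}$.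
   Context: Scale-irregular Vicsek set. Let $\mathbf{l}=(l_k)_{k\ge1}$ be a sequence of odd integers $l_k\ge3$, and set $l_0:=1$. In the complex plane put $q_0:=0$ and $q_j:=\exp((2j-1)\pi i/4)$ for $1\le j\le4$, and let $K_0$ be the closed (filled) square with vertices $q_1,q_2,q_3,q_4$. For an odd integer $l\ge3$ let $S_l:=\{2nl^{-1}q_j:\ 0\le n\le\frac12(l-1),\ n\in\mathbb{Z},\ 1\le j\le4\}$ (so $\#S_l=2l-1$), and for $w\in S_l$ let $F_w^l(z):=w+l^{-1}z$, $z\in\mathbb{C}$. Let $W_n:=\prod_{k=1}^nS_{l_k}$ for $n\ge1$, and for $w=w_1\cdots w_n\in W_n$ let $F_w:=F_{w_1}^{l_1}\circ\cdots\circ F_{w_n}^{l_n}$. The scale-irregular Vicsek set is the compact set $K=K^{\mathbf{l}}:=\bigcap_{n=1}^\infty\bigcup_{w\in W_n}F_w(K_0)$ with the Euclidean metric $d$. For $w\in W_n$ write $K_w:=F_w(K_0)\cap K$. The measure $\mu$ is the Borel probability measure on $K$ determined by $\mu(K_w)=(\#W_n)^{-1}=\prod_{k=1}^n(2l_k-1)^{-1}$ for all $n\ge1$, $w\in W_n$. Graphs. Let $V_0:=\{q_j\}_{j=0}^4$ and $V_n:=\bigcup_{w\in W_n}F_w(V_0)$ for $n\ge1$. For $x,y\in V_n$ write $x\sim y$ (adjacent in $V_n$) if $d(x,y)=\prod_{j=0}^nl_j^{-1}$. Energy. $C(K)$ is the space of real-valued continuous functions on $K$. For $n\ge0$, $u\in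 C(K)$ let $$\mathcal{E}_{p,n}(u):=\frac12\Big(\prod_{j=0}^nl_j^{p-1}\Big)\sum_{x,y\in V_n,\ x\sim y}|u(x)-u(y)|^p$$ (sum over ordered pairs). Define $\mathcal{F}_p:=\{u\in C(K):\sup_{n\ge0}\mathcal{E}_{p,n}(u)<\infty\}$ and $\mathcal{E}_p(u):=\sup_{n\ge0}\mathcal{E}_{p,n}(u)$ for $u\in\mathcal{F}_p$. One has $f\circ u\in\mathcal{F}_p$ for $u\in\mathcal{F}_p$ and $f\in C^1(\mathbb{R})$. *)

theory Defs
  imports "HOL-Analysis.Analysis"
begin

section \<open>The scale-irregular Vicsek set\<close>

definition scale_sequence :: "(nat \<Rightarrow> nat) \<Rightarrow> bool" where
  "scale_sequence l \<longleftrightarrow> l 0 = 1 \<and> (\<forall>k\<ge>1. odd (l k) \<and> l k \<ge> 3)"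

definition vicsek_pt :: "nat \<Rightarrow> complex" where
  "vicsek_pt j = (if j = 0 then 0 else exp (of_real ((2 * real j - 1) * pi / 4) * \<i>))"

definition vicsek_square :: "complex set" where
  "vicsek_square = convex hull (vicsek_pt ` {1..4})"

definition vicsek_shifts :: "nat \<Rightarrow> complex set" where
  "vicsek_shifts l = {of_real (2 * real n / real l) * vicsek_pt j | n j. real n \<le> (real l - 1) / 2 \<and> j \<in> {1..4}}"

definition vicsek_map :: "nat \<Rightarrow> complex \<Rightarrow> complex \<Rightarrow> complex" where
  "vicsek_map l w z = w + z / of_nat l"

text \<open>
  A word \<open>w = w\<^sub>1 \<dots> w\<^sub>n\<close> is a function on \<open>{1..n}\<close>.  For \<open>n = 0\<close> there is
  exactly one (empty) word, with associated map \<open>id\<close>.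
\<close>

definition vicsek_words :: "(nat \<Rightarrow> nat) \<Rightarrow> nat \<Rightarrow> (nat \<Rightarrow> complex) set" where
  "vicsek_words l n = (\<Pi>\<^sub>E k\<in>{1..n}. vicsek_shifts (l k))"

primrec vicsek_word_map :: "(nat \<Rightarrow> nat) \<Rightarrow> nat \<Rightarrow> (nat \<Rightarrow> complex) \<Rightarrow> complex \<Rightarrow> complex" where
  "vicsek_word_map l 0 w = id"
| "vicsek_word_map l (Suc n) w = vicsek_word_map l n w \<circ> vicsek_map (l (Suc n)) (w (Suc n))"

definition vicsek_set :: "(nat \<Rightarrow> nat) \<Rightarrow> complex set" where
  "vicsek_set l = (\<Inter>n\<in>{1..}. \<Union>w\<in>vicsek_words l n. vicsek_word_map l n w ` vicsek_square)"

definition vicsek_cell :: "(nat \<Rightarrow> nat) \<Rightarrow> nat \<Rightarrow> (nat \<Rightarrow> complex) \<Rightarrow> complex set" where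
  "vicsek_cell l n w = vicsek_word_map l n w ` vicsek_square \<inter> vicsek_set l"

definition vicsek_measure :: "(nat \<Rightarrow> nat) \<Rightarrow> complex measure \<Rightarrow> bool" where
  "vicsek_measure l \<mu> \<longleftrightarrow>
     sets \<mu> = sets (restrict_space borel (vicsek_set l)) \<and>
     emeasure \<mu> (vicsek_set l) = 1 \<and>
     (\<forall>n\<ge>1. \<forall>w\<in>vicsek_words l n. emeasure \<mu> (vicsek_cell l n w) = ennreal (1 / real (card (vicsek_words l n))))"


section \<open>The p-energy\<close>

text \<open>As there is only one word of length \<open>0\<close>, \<open>vicsek_vertices l 0 = vicsek_pt ` {0..4}\<close>.\<close>

definition vicsek_vertices :: "(nat \<Rightarrow> nat) \<Rightarrow> nat \<Rightarrow> complex set" where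
  "vicsek_vertices l n = (\<Union>w\<in>vicsek_words l n. vicsek_word_map l n w ` vicsek_pt ` {0..4})"

definition vicsek_adj :: "(nat \<Rightarrow> nat) \<Rightarrow> nat \<Rightarrow> (complex \<times> complex) set" where
  "vicsek_adj l n = {(x, y). x \<in> vicsek_vertices l n \<and> y \<in> vicsek_vertices l n \<and> dist x y = (\<Prod>j=0..n. inverse (real (l j)))}"

text \<open>
  Functions on \<open>K\<close> are represented by their extensional versions, so that \<open>C_fun K\<close>
  is the set of continuous functions on \<open>K\<close>, without any information about values outside \<open>K\<close>.
\<close>

definition C_fun :: "complex set \<Rightarrow> (complex \<Rightarrow> real) set" where
  "C_fun K = {u \<in> extensional K. continuous_on K u}"

definition energy_n :: "(nat \<Rightarrow> nat) \<Rightarrow> real \<Rightarrow> nat \<Rightarrow> (complex \<Rightarrow> real) \<Rightarrow> real" where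
  "energy_n l p n u =
     1 / 2 * (\<Prod>j=0..n. real (l j) powr (p - 1)) * (\<Sum>(x, y)\<in>vicsek_adj l n. \<bar>u x - u y\<bar> powr p)"

definition energy_dom :: "(nat \<Rightarrow> nat) \<Rightarrow> real \<Rightarrow> (complex \<Rightarrow> real) set" where
  "energy_dom l p = {u \<in> C_fun (vicsek_set l). bdd_above (range (\<lambda>n. energy_n l p n u))}"

definition energy :: "(nat \<Rightarrow> nat) \<Rightarrow> real \<Rightarrow> (complex \<Rightarrow> real) \<Rightarrow> real" where
  "energy l p u = (SUP n. energy_n l p n u)"


section \<open>Measures\<close>

definition finite_borel_measure_on :: "complex set \<Rightarrow> complex measure \<Rightarrow> bool" where
  "finite_borel_measure_on K M \<longleftrightarrow> sets M = sets (restrict_space borel K) \<and> finite_measure M"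

text \<open>Only used for exponents \<open>a > 0\<close>, with the convention \<open>\<infinity>\<^sup>a = \<infinity>\<close>.\<close>

definition ennreal_powr :: "ennreal \<Rightarrow> real \<Rightarrow> ennreal" where
  "ennreal_powr x a = (if x = \<infinity> then \<infinity> else ennreal (enn2real x powr a))"

end

(*
  A cell of level n is coded by a word, and the energy of u splits into local energies of cells.
  Since every edge of level n is subdivided into l (n + 1) edges of level n + 1, Hoelder's
  inequality makes the discrete local energies increase, and their limits are additive over
  subcells.  They are therefore the cylinder masses of a finite measure on the space of infinite
  words (Ionescu-Tulcea), and Gamma u is its image under the coding map.  No differentiability of u
  along edges is needed: measures on words are compared on cylinders only.

  The triangle inequality follows from the cylinderwise estimate
  |x + y|^p <= t^(1-p) |x|^p + (1-t)^(1-p) |y|^p, which is linear in the masses, by optimising t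
  after integration.  The chain rule holds up to an error epsilon on small cylinders by the mean
  value theorem.  For the image density, let A be a compact null set and let f n be antiderivatives
  of cutoffs phi n decreasing to the indicator of A.  By the chain rule the energy of
  (f n - f m) o u is at most the image measure of a shrinking punctured neighbourhood of A;
  as f m -> 0, lower semicontinuity gives the same bound for f n o u, whose energy is at least the
  image measure of A.
*)

theory Submission
  imports Defs "HOL-Probability.Probability"
begin

section \<open>Elementary inequalities and calculus\<close>

text \<open>Words are used instead of points because neighbouring cells share a corner. Assigning
  masses to cells of \<open>K\<close> directly would raise the question whether shared corners carry
  energy; cylinders of words are disjoint, so additivity of the local energies is already
  consistency, and the image under the coding map merely adds up whatever sits over one point.

  Most comparisons are inequalities between measures known on cylinders only. These do not pass to
  complements, so a pi-lambda argument cannot treat them directly; they are first turned into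
  equations by extending the difference of the masses to a measure.

  In the image density argument, \<open>f m\<close> tending to 0 is by itself no information about
  energies, since the derivative of every \<open>f m\<close> is 1 on \<open>A\<close>. In a
  difference \<open>f n - f m\<close> these derivatives cancel on \<open>A\<close>. The mass of
  \<open>A\<close> thus disappears from the upper bound although it is still present in the lower
  bound for \<open>f n\<close>.\<close>

lemma powr_abs_add_le:
  fixes x y t p :: real
  assumes p: "1 < p" and t: "0 < t" "t < 1"
  shows "\<bar>x + y\<bar> powr p \<le> t powr (1 - p) * \<bar>x\<bar> powr p + (1 - t) powr (1 - p) * \<bar>y\<bar> powr p"
proof -
  have one_le: "1 \<le> s powr (1 - p)" if "0 < s" "s < 1" for s
    using powr_mono2'[of "1 - p" s 1] that p by simp
  have scale: "s * (a / s) powr p = s powr (1 - p) * a powr p" if "0 < s" "a \<ge> 0" for s a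
    using that by (simp add: powr_divide powr_diff)
  \<comment> \<open>Convexity is applied below at positive arguments; if one summand vanishes, the
    claim reduces to the weights being at least 1.\<close>
  consider "x = 0" | "y = 0" | "x \<noteq> 0" "y \<noteq> 0" by blast
  then show ?thesis
  proof cases
    case 1
    then show ?thesis using one_le[of "1 - t"] t by (simp add: mult_le_cancel_right1)
  next
    case 2
    then show ?thesis using one_le[of t] t by (simp add: mult_le_cancel_right1)
  next
    case 3
    have "\<bar>x + y\<bar> powr p \<le> (\<bar>x\<bar> + \<bar>y\<bar>) powr p"
      using p by (intro powr_mono2) auto
    \<comment> \<open>Dividing by the weights turns the sum into a convex combination of
      \<open>\<bar>x\<bar> / t\<close> and \<open>\<bar>y\<bar> / (1 - t)\<close>; the pth power
      then produces \<open>t * t powr (- p)\<close>, which is the factor in the claim.\<close>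
    also have "\<bar>x\<bar> + \<bar>y\<bar> = (1 - (1 - t)) *\<^sub>R (\<bar>x\<bar> / t) + (1 - t) *\<^sub>R (\<bar>y\<bar> / (1 - t))"
      using t by simp
    also have "\<dots> powr p \<le> (1 - (1 - t)) * (\<bar>x\<bar> / t) powr p + (1 - t) * (\<bar>y\<bar> / (1 - t)) powr p"
      using powr_convex[of p] p t 3 by (intro convex_onD) auto
    also have "\<dots> = t powr (1 - p) * \<bar>x\<bar> powr p + (1 - t) powr (1 - p) * \<bar>y\<bar> powr p"
      using scale[of t "\<bar>x\<bar>"] scale[of "1 - t" "\<bar>y\<bar>"] t by simp
    finally show ?thesis .
  qed
qed

text \<open>A discrete Hoelder inequality, obtained by splitting off one summand at a time with the
  two-term estimate.\<close>

lemma powr_abs_sum_le: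
  fixes a :: "nat \<Rightarrow> real"
  assumes p: "1 < p"
  shows "\<bar>\<Sum>i<N. a i\<bar> powr p \<le> real N powr (p - 1) * (\<Sum>i<N. \<bar>a i\<bar> powr p)"
proof (induction N)
  case (Suc N)
  show ?case
  proof (cases "N = 0")
    case False
    \<comment> \<open>With a weight proportional to the number of terms already collected, the first
      factor times the induction constant and the second factor both become
      \<open>real (Suc N) powr (p - 1)\<close>.\<close>
    define t where "t = real N / real (Suc N)"
    have t: "0 < t" "t < 1" "1 - t = 1 / real (Suc N)" using False by (auto simp: t_def field_simps)
    have "t powr (1 - p) * real N powr (p - 1) = real (Suc N) powr (p - 1)"
      using False by (simp add: t_def powr_divide powr_diff field_simps del: of_nat_Suc)
    moreover have "(1 - t) powr (1 - p) = real (Suc N) powr (p - 1)"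
      unfolding t(3) by (simp add: powr_divide powr_diff field_simps del: of_nat_Suc)
    moreover have "\<bar>\<Sum>i<Suc N. a i\<bar> powr p \<le> t powr (1 - p) * \<bar>\<Sum>i<N. a i\<bar> powr p + (1 - t) powr (1 - p) * \<bar>a N\<bar> powr p"
      using powr_abs_add_le[OF p t(1,2)] by simp
    moreover have "t powr (1 - p) * \<bar>\<Sum>i<N. a i\<bar> powr p \<le> t powr (1 - p) * (real N powr (p - 1) * (\<Sum>i<N. \<bar>a i\<bar> powr p))"
      using Suc by (intro mult_left_mono) auto
    ultimately show ?thesis by (simp add: distrib_left mult.assoc[symmetric])
  qed simp
qed simp

lemma C1_deriv:
  assumes "f C1_differentiable_on UNIV"
  shows "\<And>x. (f has_real_derivative deriv f x) (at x)" "continuous_on UNIV (deriv f)"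
proof -
  obtain D where D: "\<And>x. (f has_vector_derivative D x) (at x)" "continuous_on UNIV D"
    using assms unfolding C1_differentiable_on_def by auto
  then have d: "(f has_real_derivative D x) (at x)" for x
    by (simp add: has_real_derivative_iff_has_vector_derivative)
  then have "deriv f = D" by (auto intro: DERIV_imp_deriv)
  then show "\<And>x. (f has_real_derivative deriv f x) (at x)" "continuous_on UNIV (deriv f)"
    using d D(2) by auto
qed

lemma mvt_between:
  fixes a b :: real
  assumes "\<And>x. (f has_real_derivative f' x) (at x)"
  shows "\<exists>z. z \<in> closed_segment a b \<and> \<bar>f a - f b\<bar> = \<bar>f' z\<bar> * \<bar>a - b\<bar>"
proof -
  have main: "\<exists>z. z \<in> closed_segment a b \<and> \<bar>f a - f b\<bar> = \<bar>f' z\<bar> * \<bar>a - b\<bar>" if ab: "a < b" for a b :: real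
  proof -
    obtain z where z: "a < z" "z < b" "f b - f a = (b - a) * f' z"
      using MVT2[OF ab, of f f'] assms by blast
    then have "\<bar>f b - f a\<bar> = \<bar>b - a\<bar> * \<bar>f' z\<bar>" by (simp add: abs_mult)
    then show ?thesis
      using z ab by (intro exI[of _ z]) (auto simp: closed_segment_eq_real_ivl abs_minus_commute mult.commute)
  qed
  consider "a < b" | "a = b" | "b < a" by linarith
  then show ?thesis
  proof cases
    case 3
    then show ?thesis using main[OF 3] by (simp add: closed_segment_commute abs_minus_commute)
  qed (use main in auto)
qed

section \<open>Measures on sequence spaces with prescribed cylinder masses\<close>

locale symbolic =
  fixes S :: "nat \<Rightarrow> 'a set"
  assumes finite_S: "finite (S n)" and S_ne: "S n \<noteq> {}"
begin

definition \<Omega> :: "(nat \<Rightarrow> 'a) measure" where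
  "\<Omega> = PiM UNIV (\<lambda>i. count_space (S i))"

definition cyl :: "nat \<Rightarrow> (nat \<Rightarrow> 'a) \<Rightarrow> (nat \<Rightarrow> 'a) set" where
  "cyl n w = {\<eta> \<in> space \<Omega>. \<forall>k<n. \<eta> k = w k}"

text \<open>Finitely additive masses of cylinders. A prefix of length n is represented by any full
  sequence, so the first conjunct says that only its first n letters count; \<open>w(n := s)\<close>
  appends a letter. The conditions range over all sequences, also those with letters outside
  \<open>S\<close>; finiteness descends from the root to words over \<open>S\<close>.\<close>

definition mass :: "(nat \<Rightarrow> (nat \<Rightarrow> 'a) \<Rightarrow> ennreal) \<Rightarrow> bool" where
  "mass m \<longleftrightarrow> (\<forall>n w w'. (\<forall>k<n. w k = w' k) \<longrightarrow> m n w = m n w') \<and>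
     (\<forall>n w. m n w = (\<Sum>s\<in>S n. m (Suc n) (w(n := s)))) \<and> (\<forall>w. m 0 w < \<infinity>)"

lemma space_\<Omega>: "space \<Omega> = {w. \<forall>k. w k \<in> S k}"
  by (auto simp: \<Omega>_def space_PiM PiE_iff)

lemma mass_cong: "mass m \<Longrightarrow> (\<And>k. k < n \<Longrightarrow> w k = w' k) \<Longrightarrow> m n w = m n w'"
  unfolding mass_def by blast

lemma mass_step: "mass m \<Longrightarrow> m n w = (\<Sum>s\<in>S n. m (Suc n) (w(n := s)))"
  unfolding mass_def by blast

lemma mass_Suc_le:
  assumes "mass m" "w n \<in> S n"
  shows "m (Suc n) w \<le> m n w"
proof -
  have "m (Suc n) (w(n := w n)) \<le> (\<Sum>s\<in>S n. m (Suc n) (w(n := s)))"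
    using assms(2) finite_S by (intro member_le_sum) auto
  then show ?thesis by (simp only: mass_step[OF assms(1), of n w] fun_upd_triv)
qed

lemma mass_finite:
  assumes "mass m" "\<And>k. k < n \<Longrightarrow> w k \<in> S k"
  shows "m n w \<le> m 0 w0" "m n w < \<infinity>"
proof -
  show le: "m n w \<le> m 0 w0" using assms(2)
  proof (induction n)
    case 0
    then show ?case using mass_cong[OF assms(1), of 0 w w0] by simp
  next
    case (Suc n)
    then show ?case using mass_Suc_le[OF assms(1), of w n] by (meson lessI less_SucI order_trans)
  qed
  with assms(1) show "m n w < \<infinity>" unfolding mass_def by (metis order_le_less_trans)
qed

lemma cyl_PiE: "cyl n w = prod_emb UNIV (\<lambda>i. count_space (S i)) {0..<n} {restrict w {0..<n}}"
  by (auto simp: cyl_def prod_emb_def \<Omega>_def space_PiM fun_eq_iff restrict_def PiE_iff) metis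

lemma cyl_0 [simp]: "cyl 0 w = space \<Omega>"
  by (auto simp: cyl_def)

lemma space_\<Omega>_ne: "space \<Omega> \<noteq> {}"
proof -
  have "(\<lambda>k. SOME s. s \<in> S k) \<in> space \<Omega>"
    unfolding space_\<Omega> using S_ne by (simp add: some_in_eq)
  then show ?thesis by blast
qed

lemma cyl_sets [measurable]: "cyl n w \<in> sets \<Omega>"
proof (cases "\<forall>k<n. w k \<in> S k")
  case True
  have "{restrict w {0..<n}} = PiE {0..<n} (\<lambda>k. {w k})"
    by (auto simp: fun_eq_iff PiE_iff extensional_def restrict_def)
  then show ?thesis
    unfolding cyl_PiE \<Omega>_def using True
    by (intro measurable_prod_emb) (auto intro!: sets_PiM_I_finite)
next
  case False
  then obtain k where "k < n" "w k \<notin> S k" by blast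
  then have "cyl n w = {}" by (auto simp: cyl_def space_\<Omega>) metis
  then show ?thesis by simp
qed

text \<open>The transition kernels are the conditional masses of the next letter given the prefix.
  Their products telescope to the prescribed mass divided by the total \<open>c\<close>, and
  rescaling by \<open>c\<close> undoes the normalisation. Total mass 0 is set apart since it cannot
  be normalised.\<close>

lemma mass_extension:
  assumes m: "mass m"
  shows "\<exists>M. sets M = sets \<Omega> \<and> finite_measure M \<and> (\<forall>n. \<forall>w\<in>space \<Omega>. emeasure M (cyl n w) = m n w)"
proof (cases "m 0 (\<lambda>_. undefined) = 0")
  case True
  have "m n w = 0" if "w \<in> space \<Omega>" for n w
    using mass_finite(1)[OF m, of n w "\<lambda>_. undefined"] that True by (auto simp: space_\<Omega>)
  then show ?thesis
    by (intro exI[of _ "null_measure \<Omega>"]) (auto intro!: finite_measureI)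
next
  case False
  let ?r = "\<lambda>_::nat. undefined :: 'a"
  define c where "c = m 0 ?r"
  have c: "c \<noteq> 0" "c < \<infinity>" using False mass_finite(2)[OF m, of 0 ?r] unfolding c_def by auto
  define M where "M i = count_space (S i)" for i
  \<comment> \<open>Below a prefix of mass 0 the quotient is meaningless, so the next letter is
    taken uniformly there to keep the kernel a probability. The children of such a prefix have mass
    0 as well, so this choice does not affect any cylinder mass.\<close>
  define d where "d n w s = (if m n w = 0 then ennreal (1 / card (S n)) else m (Suc n) (w(n := s)) / m n w)"
    for n w s
  define P where "P n w = density (M n) (d n w)" for n w
  \<comment> \<open>Finite products of the alphabets are discrete, which makes every kernel
    measurable and every prefix an event.\<close>
  have PiM_eq: "PiM {0..<n} M = count_space (PiE {0..<n} S)" for n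
    unfolding M_def using finite_S by (intro count_space_PiM_finite) (auto intro: countable_finite)
  have card: "card (S n) > 0" for n using finite_S[of n] S_ne[of n] by (simp add: card_gt_0_iff)
  have prob: "prob_space (P n x)" if "x \<in> PiE {0..<n} S" for n x
  proof (rule prob_spaceI)
    have "emeasure (P n x) (space (P n x)) = (\<Sum>s\<in>S n. d n x s)"
      using finite_S[of n] by (simp add: P_def emeasure_density M_def nn_integral_count_space_finite)
    also have "\<dots> = 1"
    proof (cases "m n x = 0")
      case True
      then have "(\<Sum>s\<in>S n. d n x s) = (\<Sum>s\<in>S n. ennreal (1 / card (S n)))" by (simp add: d_def)
      also have "\<dots> = ennreal (\<Sum>s\<in>S n. 1 / card (S n))" by (subst sum_ennreal) auto
      also have "\<dots> = 1" using card[of n] by simp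
      finally show ?thesis .
    next
      case False
      have "(\<Sum>s\<in>S n. d n x s) = (\<Sum>s\<in>S n. m (Suc n) (x(n := s))) / m n x"
        using False by (simp add: d_def divide_ennreal_def sum_distrib_right)
      also have "\<dots> = m n x / m n x" by (simp only: mass_step[OF m, of n x, symmetric])
      also have "\<dots> = 1" using False mass_finite(2)[OF m, of n x] that
        by (intro ennreal_divide_self) (auto simp: PiE_iff)
      finally show ?thesis .
    qed
    finally show "emeasure (P n x) (space (P n x)) = 1" .
  qed
  interpret IT: Ionescu_Tulcea P M
  proof (rule Ionescu_Tulcea.intro)
    show "P i \<in> PiM {0..<i} M \<rightarrow>\<^sub>M subprob_algebra (M i)" for i
    proof -
      have "P i x \<in> space (subprob_algebra (M i))" if "x \<in> PiE {0..<i} S" for x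
        using prob[OF that] by (auto simp: space_subprob_algebra P_def prob_space_imp_subprob_space)
      then show ?thesis unfolding PiM_eq measurable_count_space_eq1 by blast
    qed
    show "prob_space (P i x)" if "x \<in> space (PiM {0..<i} M)" for i x
      using prob that unfolding PiM_eq by simp
  qed
  have r: "?r \<in> space (PiM {0..<0} M)" by (simp add: PiM_eq)
  \<comment> \<open>\<open>?r\<close> is the empty prefix, the only element of a product over no
    indices; \<open>IT.C 0 n ?r\<close> is the joint law of the first n letters.\<close>
  have C: "emeasure (IT.C 0 n ?r) {restrict w {0..<n}} = m n w / c" if w: "w \<in> space \<Omega>" for n w
  proof (induction n)
    case 0
    have "m 0 w = c" unfolding c_def using mass_cong[OF m, of 0 w ?r] by simp
    moreover have "restrict w {0..<0} = ?r" by auto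
    ultimately show ?case using c by (simp add: PiM_empty ennreal_divide_self)
  next
    case (Suc n)
    let ?w = "restrict w {0..<n}" and ?w' = "restrict w {0..<Suc n}"
    have wk: "w k \<in> S k" for k using w by (auto simp: space_\<Omega>)
    have ww: "?w \<in> PiE {0..<n} S" "?w' \<in> PiE {0..<Suc n} S" using wk by auto
    have spC: "space (IT.C 0 n ?r) = PiE {0..<n} S"
      using IT.space_C[OF r, of n] by (simp add: PiM_eq)
    have stC: "sets (IT.C 0 n ?r) = Pow (PiE {0..<n} S)"
      using IT.sets_C[OF r, of n] by (simp add: PiM_eq)
    have "sets (IT.C 0 n ?r) = sets (PiM {0..<n} M)" using IT.sets_C[OF r, of n] by simp
    from measurable_cong_sets[OF this refl] have eP: "IT.eP n \<in> IT.C 0 n ?r \<rightarrow>\<^sub>M subprob_algebra (PiM {0..<Suc n} M)"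
      using IT.measurable_eP[of n] by blast
    have "emeasure (IT.C 0 (Suc n) ?r) {?w'} = (\<integral>\<^sup>+x. emeasure (IT.eP n x) {?w'} \<partial>IT.C 0 n ?r)"
    proof -
      have "space (IT.C 0 n ?r) \<noteq> {}" using ww(1) unfolding spC by blast
      moreover have "{?w'} \<in> sets (PiM {0..<Suc n} M)" using ww(2) unfolding PiM_eq by simp
      ultimately show ?thesis using emeasure_bind[OF _ eP] by simp
    qed
    \<comment> \<open>The kernel keeps the prefix x and appends one letter, so it can hit the
      singleton only from the matching prefix and with the matching letter.\<close>
    also have "\<dots> = (\<integral>\<^sup>+x. d n ?w (w n) * indicator {?w} x \<partial>IT.C 0 n ?r)"
    proof (rule nn_integral_cong)
      fix x assume "x \<in> space (IT.C 0 n ?r)"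
      then have x: "x \<in> PiE {0..<n} S" by (simp add: spC)
      have "emeasure (IT.eP n x) {?w'} = emeasure (P n x) ((\<lambda>s. x(n := s)) -` {?w'} \<inter> S n)"
        using IT.emeasure_eP[of x n "{?w'}"] x ww by (auto simp: PiM_eq M_def)
      also have "(\<lambda>s. x(n := s)) -` {?w'} \<inter> S n = (if x = ?w then {w n} else {})"
      proof -
        have "x(n := s) = ?w' \<longleftrightarrow> x = ?w \<and> s = w n" for s
        proof
          assume h: "x(n := s) = ?w'"
          have "x k = ?w k" for k
            using fun_cong[OF h, of k] PiE_arb[OF x, of k] by (cases "k < n") auto
          then have "x = ?w" by blast
          with fun_cong[OF h, of n] show "x = ?w \<and> s = w n" by simp
        next
          have "?w(n := w n) = ?w'" by (rule ext) auto
          moreover assume "x = ?w \<and> s = w n"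
          ultimately show "x(n := s) = ?w'" by simp
        qed
        then show ?thesis using wk[of n] by force
      qed
      also have "emeasure (P n x) \<dots> = d n ?w (w n) * indicator {?w} x"
      proof -
        have "emeasure (P n y) {w n} = d n y (w n)" for y
          using wk[of n] finite_S[of n]
          by (simp add: P_def M_def emeasure_density nn_integral_count_space_finite indicator_def
               if_distrib sum.delta cong: if_cong)
        then show ?thesis by simp
      qed
      finally show "emeasure (IT.eP n x) {?w'} = d n ?w (w n) * indicator {?w} x" .
    qed
    also have "\<dots> = d n ?w (w n) * emeasure (IT.C 0 n ?r) {?w}"
      using ww by (subst nn_integral_cmult_indicator) (auto simp: stC)
    also have "\<dots> = d n ?w (w n) * (m n w / c)" by (simp only: Suc)
    also have "\<dots> = m (Suc n) w / c"
    proof -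
      have e: "m n ?w = m n w" "m (Suc n) (?w(n := w n)) = m (Suc n) w"
        by (auto intro!: mass_cong[OF m])
      have fin: "m n w < \<infinity>" using mass_finite(2)[OF m] wk by auto
      show ?thesis
      proof (cases "m n w = 0")
        case True
        then show ?thesis using mass_Suc_le[of m w n] m wk[of n] by (simp add: e)
      next
        case False
        have "inverse (m n w) * m n w = 1"
          using ennreal_divide_self[OF False fin[unfolded infinity_ennreal_def]]
          by (simp add: divide_ennreal_def mult.commute)
        then have "m (Suc n) w * inverse (m n w) * (m n w * inverse c) = m (Suc n) w * inverse c"
          by (metis mult.assoc mult.right_neutral)
        then show ?thesis unfolding d_def e using False by (simp add: divide_ennreal_def)
      qed
    qed
    finally show ?case .
  qed
  define L where "L = scale_measure c IT.PF.lim"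
  have setsL: "sets L = sets \<Omega>" by (simp add: L_def \<Omega>_def M_def[symmetric, abs_def])
  have L: "emeasure L (cyl n w) = m n w" if w: "w \<in> space \<Omega>" for n w
  proof -
    have X: "{restrict w {0..<n}} \<in> sets (PiM {0..<n} M)"
      using w by (auto simp: PiM_eq space_\<Omega>)
    have M': "M = (\<lambda>i. count_space (S i))" by (simp add: M_def fun_eq_iff)
    have "emeasure L (cyl n w) = c * emeasure (IT.CI {0..<n}) {restrict w {0..<n}}"
      unfolding L_def cyl_PiE M'[symmetric] using IT.lim[OF _ X] by simp
    also have "emeasure (IT.CI {0..<n}) {restrict w {0..<n}} = m n w / c"
    proof -
      have "prod_emb {0..<n} M {0..<n} {restrict w {0..<n}} = {restrict w {0..<n}}"
        using sets.sets_into_space[OF X] by (intro prod_emb_id) (auto simp: space_PiM)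
      then show ?thesis using IT.emeasure_CI[OF order_refl X] C[OF w, of n] by simp
    qed
    also have "c * (m n w / c) = m n w"
      using ennreal_divide_self[of c] c by (simp add: divide_ennreal_def mult.left_commute[of c])
    finally show ?thesis .
  qed
  have "finite_measure L"
  proof
    obtain w where w: "w \<in> space \<Omega>" using space_\<Omega>_ne by blast
    show "emeasure L (space L) \<noteq> \<infinity>"
      using L[OF w, of 0] mass_finite(2)[OF m, of 0 w] sets_eq_imp_space_eq[OF setsL] by simp
  qed
  with setsL L show ?thesis by auto
qed

section \<open>Closure properties of consistent masses\<close>

lemma mass_measure:
  assumes "sets M = sets \<Omega>"
  shows "finite_measure M \<Longrightarrow> mass (\<lambda>n w. emeasure M (cyl n w))"
  unfolding mass_def
proof (intro conjI allI impI)
  fix n and w w' :: "nat \<Rightarrow> 'a" assume "\<forall>k<n. w k = w' k"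
  then show "emeasure M (cyl n w) = emeasure M (cyl n w')" by (simp add: cyl_def)
next
  fix n and w :: "nat \<Rightarrow> 'a"
  have "cyl n w = (\<Union>s\<in>S n. cyl (Suc n) (w(n := s)))"
    by (auto simp: cyl_def space_\<Omega> less_Suc_eq)
  moreover have "disjoint_family_on (\<lambda>s. cyl (Suc n) (w(n := s))) (S n)"
    by (auto simp: disjoint_family_on_def cyl_def)
  ultimately show "emeasure M (cyl n w) = (\<Sum>s\<in>S n. emeasure M (cyl (Suc n) (w(n := s))))"
    using finite_S[of n] assms by (simp add: sum_emeasure image_subset_iff)
next
  fix w :: "nat \<Rightarrow> 'a"
  assume "finite_measure M"
  then show "emeasure M (cyl 0 w) < \<infinity>"
    by (simp add: finite_measure.emeasure_finite less_top[symmetric])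
qed

lemma mass_add:
  assumes m: "mass m1" "mass m2"
  shows "mass (\<lambda>n w. m1 n w + m2 n w)"
  unfolding mass_def
proof (intro conjI allI impI)
  fix n and w w' :: "nat \<Rightarrow> 'a" assume "\<forall>k<n. w k = w' k"
  then show "m1 n w + m2 n w = m1 n w' + m2 n w'"
    using mass_cong[OF m(1), of n w w'] mass_cong[OF m(2), of n w w'] by simp
next
  fix n and w :: "nat \<Rightarrow> 'a"
  show "m1 n w + m2 n w = (\<Sum>s\<in>S n. m1 (Suc n) (w(n := s)) + m2 (Suc n) (w(n := s)))"
    by (simp only: sum.distrib mass_step[OF m(1), of n w] mass_step[OF m(2), of n w])
next
  show "m1 0 w + m2 0 w < \<infinity>" for w :: "nat \<Rightarrow> 'a"
    using mass_finite(2)[OF m(1), of 0 w] mass_finite(2)[OF m(2), of 0 w] by simp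
qed

lemma mass_cmult:
  assumes m: "mass m" and c: "c < \<infinity>"
  shows "mass (\<lambda>n w. c * m n w)"
  unfolding mass_def
proof (intro conjI allI impI)
  fix n and w w' :: "nat \<Rightarrow> 'a" assume "\<forall>k<n. w k = w' k"
  then show "c * m n w = c * m n w'"
    using mass_cong[OF m, of n w w'] by simp
next
  fix n and w :: "nat \<Rightarrow> 'a"
  show "c * m n w = (\<Sum>s\<in>S n. c * m (Suc n) (w(n := s)))"
    by (simp only: sum_distrib_left[symmetric] mass_step[OF m, of n w])
next
  show "c * m 0 w < \<infinity>" for w :: "nat \<Rightarrow> 'a"
    using mass_finite(2)[OF m, of 0 w] c by (simp add: ennreal_mult_less_top)
qed

lemma mass_diff:
  assumes m: "mass m1" "mass m2"
    and le: "\<And>n w. m2 n w \<le> m1 n w" "\<And>n w. m2 n w < \<infinity>"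
  shows "mass (\<lambda>n w. m1 n w - m2 n w)"
  unfolding mass_def
proof (intro conjI allI impI)
  fix n and w w' :: "nat \<Rightarrow> 'a" assume "\<forall>k<n. w k = w' k"
  then show "m1 n w - m2 n w = m1 n w' - m2 n w'"
    using mass_cong[OF m(1), of n w w'] mass_cong[OF m(2), of n w w'] by simp
next
  fix n and w :: "nat \<Rightarrow> 'a"
  let ?u = "\<lambda>s. w(n := s)"
  \<comment> \<open>Truncated subtraction does not distribute over sums. Adding \<open>m2\<close>
    back reduces additivity of the difference to that of \<open>m1\<close>; finiteness of
    \<open>m2\<close> then permits cancellation.\<close>
  have "(\<Sum>s\<in>S n. m1 (Suc n) (?u s) - m2 (Suc n) (?u s)) + m2 n w
      = (\<Sum>s\<in>S n. m1 (Suc n) (?u s) - m2 (Suc n) (?u s) + m2 (Suc n) (?u s))"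
    by (simp only: sum.distrib mass_step[OF m(2), of n w])
  also have "\<dots> = m1 n w"
    unfolding mass_step[OF m(1), of n w] by (intro sum.cong refl diff_add_cancel_ennreal le)
  finally show "m1 n w - m2 n w = (\<Sum>s\<in>S n. m1 (Suc n) (?u s) - m2 (Suc n) (?u s))"
    using le(2)[of n w] by (metis ennreal_add_diff_cancel_right infinity_ennreal_def less_irrefl)
next
  fix w :: "nat \<Rightarrow> 'a"
  have "m1 0 w < \<infinity>" using m(1) unfolding mass_def by blast
  then show "m1 0 w - m2 0 w < \<infinity>"
    using diff_le_self_ennreal le_less_trans by blast
qed

section \<open>Comparison of measures through cylinders\<close>

text \<open>An event on one coordinate is a finite union of cylinders long enough to reach it. The
  empty set joins the generators because two cylinders are nested or disjoint, so that the family is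
  stable under intersection.\<close>

lemma sets_\<Omega>_cyl: "sets \<Omega> = sigma_sets (space \<Omega>) (insert {} {cyl n w | n w. True})" (is "_ = sigma_sets _ ?G")
proof
  show "sigma_sets (space \<Omega>) ?G \<subseteq> sets \<Omega>"
    by (rule sets.sigma_sets_subset) auto
  have "{w \<in> space \<Omega>. w i \<in> A} \<in> sigma_sets (space \<Omega>) ?G" for i A
  proof -
    let ?B = "{v \<in> PiE {0..<Suc i} S. v i \<in> A}"
    have "{w \<in> space \<Omega>. w i \<in> A} = (\<Union>v\<in>?B. cyl (Suc i) v)"
    proof (intro equalityI subsetI)
      fix w assume "w \<in> {w \<in> space \<Omega>. w i \<in> A}"
      then have "restrict w {0..<Suc i} \<in> ?B" "w \<in> cyl (Suc i) (restrict w {0..<Suc i})"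
        by (auto simp: space_\<Omega> cyl_def)
      then show "w \<in> (\<Union>v\<in>?B. cyl (Suc i) v)" by blast
    qed (auto simp: cyl_def)
    moreover have "(\<Union>v\<in>?B. cyl (Suc i) v) \<in> sigma_sets (space \<Omega>) ?G"
    proof (rule sigma_sets_UNION)
      have "finite ?B" using finite_S by (intro finite_subset[OF _ finite_PiE[of "{0..<Suc i}" S]]) auto
      then show "countable (cyl (Suc i) ` ?B)" by (intro countable_finite finite_imageI)
    qed auto
    ultimately show ?thesis by simp
  qed
  then have gen: "{{w \<in> space \<Omega>. w i \<in> A} | i A. i \<in> UNIV \<and> A \<in> sets (count_space (S i))} \<subseteq> sigma_sets (space \<Omega>) ?G"
    by blast
  have "sets \<Omega> = sigma_sets (space \<Omega>) {{w \<in> space \<Omega>. w i \<in> A} | i A. i \<in> UNIV \<and> A \<in> sets (count_space (S i))}"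
    by (simp add: \<Omega>_def sets_PiM_single space_PiM)
  also have "\<dots> \<subseteq> sigma_sets (space \<Omega>) ?G" using gen by (rule sigma_sets_mono)
  finally show "sets \<Omega> \<subseteq> sigma_sets (space \<Omega>) ?G" .
qed

lemma Int_stable_cyl: "Int_stable (insert {} {cyl n w | n w. True})"
proof -
  have "cyl n w \<inter> cyl k v \<in> insert {} {cyl n w | n w. True}" for n k w v
  proof (cases "cyl n w \<inter> cyl k v = {}")
    case False
    then obtain x where "x \<in> cyl n w" "x \<in> cyl k v" by blast
    then have "cyl n w \<inter> cyl k v = cyl (max n k) x"
      by (auto simp: cyl_def less_max_iff_disj)
    then show ?thesis by blast
  qed simp
  then show ?thesis unfolding Int_stable_def by blast
qed

text \<open>The pi-lambda argument runs directly on the identity \<open>A + B = C\<close>, so no sum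
  of measures has to be formed. Finiteness turns all values into reals, where complements can be
  subtracted.\<close>

lemma add_eq_if_cyl:
  assumes fin: "finite_measure A" "finite_measure B" "finite_measure C"
    and sets: "sets A = sets \<Omega>" "sets B = sets \<Omega>" "sets C = sets \<Omega>"
    and eq: "\<And>n w. w \<in> space \<Omega> \<Longrightarrow> emeasure A (cyl n w) + emeasure B (cyl n w) = emeasure C (cyl n w)"
    and X: "X \<in> sets \<Omega>"
  shows "emeasure A X + emeasure B X = emeasure C X"
proof -
  interpret A: finite_measure A by fact
  interpret B: finite_measure B by fact
  interpret C: finite_measure C by fact
  have sp: "space A = space \<Omega>" "space B = space \<Omega>" "space C = space \<Omega>"
    using sets by (auto dest: sets_eq_imp_space_eq)
  have cy: "measure A (cyl n w) + measure B (cyl n w) = measure C (cyl n w)" for n w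
  proof (cases "cyl n w = {}")
    case False
    then obtain v where v: "v \<in> space \<Omega>" "cyl n w = cyl n v" by (auto simp: cyl_def)
    show ?thesis
      using eq[OF v(1), of n] unfolding v(2)
      by (simp add: A.emeasure_eq_measure B.emeasure_eq_measure C.emeasure_eq_measure
          ennreal_plus[symmetric] del: ennreal_plus)
  qed simp
  have G: "insert {} {cyl n w | n w. True} \<subseteq> Pow (space \<Omega>)" by (auto simp: cyl_def)
  have "measure A X + measure B X = measure C X"
    using Int_stable_cyl G X[unfolded sets_\<Omega>_cyl]
  proof (induction rule: sigma_sets_induct_disjoint)
    case (basic Y)
    then show ?case using cy by auto
  next
    case (compl Y)
    then have "Y \<in> sets \<Omega>" by (simp add: sets_\<Omega>_cyl)
    then show ?case
      using compl cy[of 0] A.finite_measure_compl[of Y] B.finite_measure_compl[of Y] C.finite_measure_compl[of Y]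
      by (simp add: sets sp)
  next
    case (union Y)
    have Y: "range Y \<subseteq> sets \<Omega>" using union by (auto simp: sets_\<Omega>_cyl)
    have "(\<lambda>i. measure A (Y i) + measure B (Y i)) sums (measure A (\<Union>i. Y i) + measure B (\<Union>i. Y i))"
      using Y union(1) sets by (intro sums_add A.finite_measure_UNION B.finite_measure_UNION) auto
    moreover have "(\<lambda>i. measure C (Y i)) sums measure C (\<Union>i. Y i)"
      using Y union(1) sets by (intro C.finite_measure_UNION) auto
    ultimately show ?case using union by (simp add: sums_unique2)
  qed (auto simp: cyl_def)
  then show ?thesis
    by (simp add: A.emeasure_eq_measure B.emeasure_eq_measure C.emeasure_eq_measure
          ennreal_plus[symmetric] del: ennreal_plus)
qed

text \<open>The defect \<open>N - M\<close> on cylinders is a consistent mass. Its extension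
  \<open>D\<close> replaces the inequality by \<open>M + D = N\<close>, which follows from its
  validity on cylinders.\<close>

lemma le_if_cyl_le:
  assumes fin: "finite_measure M" "finite_measure N"
    and sets: "sets M = sets \<Omega>" "sets N = sets \<Omega>"
    and le: "\<And>n w. w \<in> space \<Omega> \<Longrightarrow> emeasure M (cyl n w) \<le> emeasure N (cyl n w)"
    and X: "X \<in> sets \<Omega>"
  shows "emeasure M X \<le> emeasure N X"
proof -
  have le': "emeasure M (cyl n w) \<le> emeasure N (cyl n w)" for n w
  proof (cases "cyl n w = {}")
    case False
    then obtain v where "v \<in> space \<Omega>" "cyl n w = cyl n v" by (auto simp: cyl_def)
    then show ?thesis using le[of v n] by simp
  qed simp
  have "mass (\<lambda>n w. emeasure N (cyl n w) - emeasure M (cyl n w))"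
    using finite_measure.emeasure_finite[OF fin(1)]
    by (intro mass_diff mass_measure fin sets le') (simp add: less_top)
  from mass_extension[OF this] obtain D where D: "sets D = sets \<Omega>" "finite_measure D"
    "\<And>n w. w \<in> space \<Omega> \<Longrightarrow> emeasure D (cyl n w) = emeasure N (cyl n w) - emeasure M (cyl n w)" by blast
  have "emeasure M X + emeasure D X = emeasure N X"
  proof (rule add_eq_if_cyl[OF fin(1) D(2) fin(2) sets(1) D(1) sets(2) _ X])
    fix n w assume "w \<in> space \<Omega>"
    then have "emeasure D (cyl n w) = emeasure N (cyl n w) - emeasure M (cyl n w)" by (rule D(3))
    then show "emeasure M (cyl n w) + emeasure D (cyl n w) = emeasure N (cyl n w)"
      using diff_add_cancel_ennreal[OF le'[of n w]] by (simp add: add.commute)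
  qed
  then show ?thesis by (metis le_iff_add)
qed

lemma eq_if_cyl_eq:
  assumes "finite_measure M" "finite_measure N" "sets M = sets \<Omega>" "sets N = sets \<Omega>"
    and "\<And>n w. w \<in> space \<Omega> \<Longrightarrow> emeasure M (cyl n w) = emeasure N (cyl n w)"
  shows "M = N"
proof (rule measure_eqI)
  show "sets M = sets N" using assms by simp
  fix X assume "X \<in> sets M"
  then have "X \<in> sets \<Omega>" using assms by simp
  then show "emeasure M X = emeasure N X"
    using le_if_cyl_le[OF assms(1-4), of X] le_if_cyl_le[OF assms(2,1,4,3), of X] assms(5)
    by (simp add: antisym)
qed

text \<open>The right-hand side is consistent as well, so it is realised by a measure
  \<open>N\<close> and the comparison passes from cylinders to all events; from there it climbs to
  integrals by induction on nonnegative measurable functions.\<close>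

lemma nn_integral_le_if_cyl_le:
  assumes fin: "finite_measure M" "finite_measure M1" "finite_measure M2"
    and sets: "sets M = sets \<Omega>" "sets M1 = sets \<Omega>" "sets M2 = sets \<Omega>"
    and ab: "a < \<infinity>" "b < \<infinity>"
    and le: "\<And>n w. w \<in> space \<Omega> \<Longrightarrow>
      emeasure M (cyl n w) \<le> a * emeasure M1 (cyl n w) + b * emeasure M2 (cyl n w)"
    and g: "g \<in> borel_measurable \<Omega>"
  shows "(\<integral>\<^sup>+x. g x \<partial>M) \<le> a * (\<integral>\<^sup>+x. g x \<partial>M1) + b * (\<integral>\<^sup>+x. g x \<partial>M2)"
proof -
  have "mass (\<lambda>n w. a * emeasure M1 (cyl n w) + b * emeasure M2 (cyl n w))"
    by (intro mass_add mass_cmult mass_measure fin sets ab)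
  from mass_extension[OF this] obtain N where N: "sets N = sets \<Omega>" "finite_measure N"
    "\<And>n w. w \<in> space \<Omega> \<Longrightarrow> emeasure N (cyl n w) = a * emeasure M1 (cyl n w) + b * emeasure M2 (cyl n w)"
    by blast
  have fin': "finite_measure (scale_measure a M1)" "finite_measure (scale_measure b M2)"
    using ab finite_measure.emeasure_finite[OF fin(2)] finite_measure.emeasure_finite[OF fin(3)]
    by (auto intro!: finite_measureI simp: ennreal_mult_eq_top_iff)
  have M: "emeasure M X \<le> a * emeasure M1 X + b * emeasure M2 X" if X: "X \<in> sets \<Omega>" for X
  proof -
    have "emeasure M X \<le> emeasure N X"
    proof (rule le_if_cyl_le[OF fin(1) N(2) sets(1) N(1) _ X])
      fix n w assume w: "w \<in> space \<Omega>"
      show "emeasure M (cyl n w) \<le> emeasure N (cyl n w)" unfolding N(3)[OF w] by (rule le[OF w])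
    qed
    also have "\<dots> = a * emeasure M1 X + b * emeasure M2 X"
      using add_eq_if_cyl[OF fin' N(2) _ _ N(1) _ X] N(3) sets by simp
    finally show ?thesis .
  qed
  have meas: "f \<in> borel_measurable M" "f \<in> borel_measurable M1" "f \<in> borel_measurable M2"
    if "f \<in> borel_measurable \<Omega>" for f :: "_ \<Rightarrow> ennreal"
    using that sets by (simp_all cong: measurable_cong_sets)
  have sp: "space M = space \<Omega>" "space M1 = space \<Omega>" "space M2 = space \<Omega>"
    using sets by (auto dest: sets_eq_imp_space_eq)
  show ?thesis
    using g
  proof (induction rule: borel_measurable_induct)
    case (cong f g)
    have "integral\<^sup>N N f = integral\<^sup>N N g" if "space N = space \<Omega>" for N
      using cong(3) that by (intro nn_integral_cong) simp
    then show ?case using cong(4) sp by simp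
  next
    case (set A)
    then show ?case using M sets by simp
  next
    case (mult u c)
    have "c * (\<integral>\<^sup>+x. u x \<partial>M) \<le> c * (a * (\<integral>\<^sup>+x. u x \<partial>M1) + b * (\<integral>\<^sup>+x. u x \<partial>M2))"
      by (rule mult_left_mono[OF mult(4)]) simp
    then show ?case using meas[OF mult(2)]
      by (simp add: nn_integral_cmult distrib_left mult.left_commute)
  next
    case (add u v)
    have "(\<integral>\<^sup>+x. v x \<partial>M) + (\<integral>\<^sup>+x. u x \<partial>M) \<le>
      (a * (\<integral>\<^sup>+x. v x \<partial>M1) + b * (\<integral>\<^sup>+x. v x \<partial>M2)) + (a * (\<integral>\<^sup>+x. u x \<partial>M1) + b * (\<integral>\<^sup>+x. u x \<partial>M2))"
      by (rule add_mono[OF add(7) add(6)])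
    then show ?case using meas[OF add(1)] meas[OF add(3)]
      by (simp add: nn_integral_add distrib_left ac_simps)
  next
    \<comment> \<open>Monotone convergence is applied to the left integral; on the right,
      monotonicity of the integral suffices.\<close>
    case (seq U)
    have "(\<integral>\<^sup>+x. (SUP i. U i) x \<partial>M) = (SUP i. \<integral>\<^sup>+x. U i x \<partial>M)"
      unfolding SUP_apply using \<open>incseq U\<close> meas(1)[OF seq(1)] by (rule nn_integral_monotone_convergence_SUP)
    also have "\<dots> \<le> a * (\<integral>\<^sup>+x. (SUP i. U i) x \<partial>M1) + b * (\<integral>\<^sup>+x. (SUP i. U i) x \<partial>M2)"
    proof (rule SUP_least)
      fix i
      have "(\<integral>\<^sup>+x. U i x \<partial>M) \<le> a * (\<integral>\<^sup>+x. U i x \<partial>M1) + b * (\<integral>\<^sup>+x. U i x \<partial>M2)"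
        by (rule seq.IH)
      also have "\<dots> \<le> a * (\<integral>\<^sup>+x. (SUP i. U i) x \<partial>M1) + b * (\<integral>\<^sup>+x. (SUP i. U i) x \<partial>M2)"
        by (intro add_mono mult_left_mono nn_integral_mono) (auto simp: SUP_apply intro: SUP_upper)
      finally show "(\<integral>\<^sup>+x. U i x \<partial>M) \<le> a * (\<integral>\<^sup>+x. (SUP i. U i) x \<partial>M1) + b * (\<integral>\<^sup>+x. (SUP i. U i) x \<partial>M2)" .
    qed
    finally show ?case .
  qed
qed

text \<open>Adding up over the next letter carries an inequality from longer words to shorter ones.
  Estimates that rely on small cells thereby reach every cylinder.\<close>

lemma mass_le_if_eventually:
  assumes m: "mass m1" "mass m2"
    and le: "\<And>n w. N \<le> n \<Longrightarrow> w \<in> space \<Omega> \<Longrightarrow> m1 n w \<le> m2 n w"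
    and w: "w \<in> space \<Omega>"
  shows "m1 n w \<le> m2 n w"
proof (cases "N \<le> n")
  case False
  then have "n \<le> N" by simp
  then show ?thesis using w
  proof (induction n arbitrary: w rule: inc_induct)
    case base
    then show ?case using le by simp
  next
    case (step n)
    have "m1 n w = (\<Sum>s\<in>S n. m1 (Suc n) (w(n := s)))" by (rule mass_step[OF m(1)])
    also have "\<dots> \<le> (\<Sum>s\<in>S n. m2 (Suc n) (w(n := s)))"
      using step by (intro sum_mono) (auto simp: space_\<Omega>)
    also have "\<dots> = m2 n w" by (rule mass_step[OF m(2), symmetric])
    finally show ?case .
  qed
qed (use le w in simp)

end

section \<open>The cell structure of the Vicsek set\<close>

text \<open>Consecutive corners differ by a quarter turn, so after division by
  \<open>vicsek_pt 1\<close> every corner direction is a unit of the Gaussian integers.\<close>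

lemma vicsek_pt_eq: "j \<in> {1..4} \<Longrightarrow> vicsek_pt j = vicsek_pt 1 * \<i> ^ (j - 1)"
proof -
  assume j: "j \<in> {1..4}"
  then obtain i where i: "j = Suc i" by (cases j) auto
  have "(2 * real j - 1) * pi / 4 = pi / 4 + real i * (pi / 2)" by (simp add: i field_simps)
  moreover have "vicsek_pt j = exp (of_real ((2 * real j - 1) * pi / 4) * \<i>)"
    by (simp only: vicsek_pt_def i if_False nat.distinct)
  ultimately have "vicsek_pt j = exp (of_real (pi / 4 + real i * (pi / 2)) * \<i>)" by (simp only:)
  also have "\<dots> = exp (of_real (pi / 4) * \<i>) * exp (of_real (pi / 2) * \<i>) ^ i"
    by (simp add: exp_add exp_of_nat_mult[symmetric] algebra_simps)
  also have "exp (of_real (pi / 2) * \<i>) = \<i>"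
    using exp_Euler[of "of_real (pi / 2)"] by (simp add: mult.commute cos_of_real sin_of_real del: of_real_divide)
  finally show ?thesis by (simp add: i vicsek_pt_def)
qed

lemma norm_vicsek_pt: "j \<in> {1..4} \<Longrightarrow> norm (vicsek_pt j) = 1"
  by (simp add: vicsek_pt_def)

lemma vicsek_pt_nz: "j \<in> {1..4} \<Longrightarrow> vicsek_pt j \<noteq> 0"
  using norm_vicsek_pt[of j] by auto

lemma atLeastAtMost_1_4: "{1..4::nat} = {1, 2, 3, 4}"
  by auto

lemma i_powers: "\<i> ^ (1 - 1) = 1" "\<i> ^ (2 - 1) = \<i>" "\<i> ^ (3 - 1) = -1" "\<i> ^ (4 - 1) = - \<i>"
  by (simp_all add: power2_eq_square power3_eq_cube)

lemma inj_vicsek_pt: "inj_on vicsek_pt {1..4}"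
proof (rule inj_onI)
  fix i j :: nat assume ij: "i \<in> {1..4}" "j \<in> {1..4}" "vicsek_pt i = vicsek_pt j"
  have "\<i> ^ (i - 1) = \<i> ^ (j - 1)"
    using ij(3) vicsek_pt_nz[of 1] unfolding vicsek_pt_eq[OF ij(1)] vicsek_pt_eq[OF ij(2)] by simp
  then show "i = j"
    using ij(1,2) unfolding atLeastAtMost_1_4
    by (elim insertE) (auto simp: i_powers[simplified] power2_eq_square power3_eq_cube complex_eq_iff)
qed

text \<open>Index of the corner \<open>- vicsek_pt j\<close>. Consecutive small cells on an arm in
  direction j touch at corner j of the inner one, which is corner \<open>opposite j\<close> of the
  outer one.\<close>

definition opposite :: "nat \<Rightarrow> nat" where
  "opposite j = (if j \<le> 2 then j + 2 else j - 2)"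

lemma opposite: 
  assumes "j \<in> {1..4}"
  shows "opposite j \<in> {1..4}" "vicsek_pt (opposite j) = - vicsek_pt j" "opposite j \<noteq> j" "opposite (opposite j) = j"
proof -
  have "opposite 1 = 3" "opposite 2 = 4" "opposite 3 = 1" "opposite 4 = 2" by (simp_all add: opposite_def)
  then show "vicsek_pt (opposite j) = - vicsek_pt j"
    using assms vicsek_pt_eq[of 2] vicsek_pt_eq[of 3] vicsek_pt_eq[of 4] unfolding atLeastAtMost_1_4
    by (elim insertE) (auto simp: power2_eq_square power3_eq_cube simp del: One_nat_def)
qed (use assms in \<open>auto simp: opposite_def atLeastAtMost_1_4\<close>)

lemma compact_vicsek_square: "compact vicsek_square"
  unfolding vicsek_square_def by (intro compact_convex_hull finite_imp_compact) simp

lemma convex_vicsek_square: "convex vicsek_square"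
  unfolding vicsek_square_def by simp

lemma vicsek_square_pt: "j \<in> {1..4} \<Longrightarrow> vicsek_pt j \<in> vicsek_square"
  unfolding vicsek_square_def by (intro hull_inc) simp

lemma zero_vicsek_square: "0 \<in> vicsek_square"
proof -
  have "(1 / 2) *\<^sub>R vicsek_pt 1 + (1 / 2) *\<^sub>R vicsek_pt (opposite 1) \<in> vicsek_square"
    by (intro convexD[OF convex_vicsek_square] vicsek_square_pt opposite(1)) auto
  moreover have "vicsek_pt (opposite 1) = - vicsek_pt 1" by (rule opposite(2)) simp
  ultimately show ?thesis by simp
qed

lemma vicsek_square_cball: "vicsek_square \<subseteq> cball 0 1"
  unfolding vicsek_square_def by (rule hull_minimal) (auto simp: norm_vicsek_pt)

section \<open>Words, scales and centres of cells\<close>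

locale vicsek =
  fixes l :: "nat \<Rightarrow> nat" and p :: real
  assumes l: "scale_sequence l" and p: "1 < p"
begin

definition S :: "nat \<Rightarrow> complex set" where
  "S n = vicsek_shifts (l (Suc n))"

definition L :: "nat \<Rightarrow> real" where
  "L n = (\<Prod>j=0..n. real (l j))"

text \<open>
  Letters are numbered from 0: \<open>w k\<close> is the letter \<open>w\<^sub>k\<^sub>+\<^sub>1\<close> of the paper, so that
  \<open>F\<^sub>w z = centre n w + z / L n\<close> for a word of length \<open>n\<close>.  Letters from position \<open>n\<close> on are ignored.
\<close>

definition centre :: "nat \<Rightarrow> (nat \<Rightarrow> complex) \<Rightarrow> complex" where
  "centre n w = (\<Sum>k<n. w k / of_real (L k))"

definition vertex :: "nat \<Rightarrow> (nat \<Rightarrow> complex) \<Rightarrow> nat \<Rightarrow> complex" where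
  "vertex n w j = centre n w + vicsek_pt j / of_real (L n)"

definition words :: "nat \<Rightarrow> (nat \<Rightarrow> complex) set" where
  "words n = PiE {0..<n} S"

definition half :: "nat \<Rightarrow> nat" where
  "half n = (l (Suc n) - 1) div 2"

lemma l_eq: "l (Suc n) = 2 * half n + 1" and half_pos: "half n \<ge> 1"
proof -
  have "odd (l (Suc n))" "l (Suc n) \<ge> 3" using l unfolding scale_sequence_def by auto
  then show "l (Suc n) = 2 * half n + 1" "half n \<ge> 1"
    unfolding half_def by (auto elim!: oddE)
qed

lemma l_ge: "l (Suc n) \<ge> 3"
  using l_eq[of n] half_pos[of n] by simp

lemma L_0 [simp]: "L 0 = 1"
  using l by (simp add: L_def scale_sequence_def)

lemma L_Suc: "L (Suc n) = L n * real (l (Suc n))"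
  by (simp add: L_def)

lemma L_ge: "L n \<ge> 3 ^ n"
proof (induction n)
  case (Suc n)
  then have "3 * 3 ^ n \<le> real (l (Suc n)) * L n" using l_ge[of n] by (intro mult_mono) auto
  then show ?case by (simp add: L_Suc mult.commute)
qed simp

lemma L_pos [simp]: "L n > 0"
  by (rule less_le_trans[OF _ L_ge]) simp

lemma L_nz [simp]: "L n \<noteq> 0"
  using L_pos[of n] by linarith

lemma S_eq: "S n = {of_real (2 * real m / real (l (Suc n))) * vicsek_pt j | m j. m \<le> half n \<and> j \<in> {1..4}}"
proof -
  have "real m \<le> (real (l (Suc n)) - 1) / 2 \<longleftrightarrow> m \<le> half n" for m
    by (simp add: l_eq)
  then show ?thesis unfolding S_def vicsek_shifts_def by simp
qed

lemma S_memI: "m \<le> half n \<Longrightarrow> j \<in> {1..4} \<Longrightarrow> of_real (2 * real m / real (l (Suc n))) * vicsek_pt j \<in> S n"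
  unfolding S_eq by blast

lemma zero_S: "0 \<in> S n"
  using S_memI[of 0 n 1] by simp

sublocale symbolic S
proof
  show "finite (S n)" for n
  proof -
    have "S n \<subseteq> (\<lambda>(m, j). of_real (2 * real m / real (l (Suc n))) * vicsek_pt j) ` ({..half n} \<times> {1..4})"
    proof
      fix s assume "s \<in> S n"
      then obtain m j where "s = of_real (2 * real m / real (l (Suc n))) * vicsek_pt j" "m \<le> half n" "j \<in> {1..4}"
        unfolding S_eq by blast
      then show "s \<in> (\<lambda>(m, j). of_real (2 * real m / real (l (Suc n))) * vicsek_pt j) ` ({..half n} \<times> {1..4})"
        by (intro image_eqI[of _ _ "(m, j)"]) auto
    qed
    then show ?thesis by (rule finite_subset) simp
  qed
  show "S n \<noteq> {}" for n using zero_S by blast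
qed

lemma norm_S:
  assumes "s \<in> S n"
  shows "norm s \<le> 1 - 1 / real (l (Suc n))"
proof -
  obtain m j where s: "s = of_real (2 * real m / real (l (Suc n))) * vicsek_pt j" "m \<le> half n" "j \<in> {1..4}"
    using assms unfolding S_eq by blast
  have "norm s = 2 * real m / real (l (Suc n))"
    using s norm_vicsek_pt[OF s(3)] by (simp add: norm_mult norm_divide del: of_real_divide)
  also have "\<dots> \<le> 2 * real (half n) / real (l (Suc n))"
    using s(2) by (intro divide_right_mono) auto
  also have "\<dots> = 1 - 1 / real (l (Suc n))"
    by (simp add: l_eq field_simps)
  finally show ?thesis .
qed

lemma centre_0 [simp]: "centre 0 w = 0"
  by (simp add: centre_def)

lemma centre_Suc: "centre (Suc n) w = centre n w + w n / of_real (L n)"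
  by (simp add: centre_def)

lemma centre_cong: "(\<And>k. k < n \<Longrightarrow> w k = w' k) \<Longrightarrow> centre n w = centre n w'"
  unfolding centre_def by (intro sum.cong) auto

lemma centre_upd [simp]: "centre n (w(n := s)) = centre n w"
  by (rule centre_cong) auto

lemma word_map_eq: "vicsek_word_map l n w z = centre n (\<lambda>k. w (Suc k)) + z / of_real (L n)"
proof (induction n arbitrary: z)
  case (Suc n)
  then show ?case
    by (simp add: centre_Suc vicsek_map_def L_Suc add_divide_distrib add.assoc)
qed simp

text \<open>Passes from words indexed from 1 to letters indexed from 0. The set \<open>A\<close> is
  arbitrary because the translation is applied both to the vertex set (\<open>vertices_eq\<close>)
  and to the full square (\<open>vicsek_set_eq\<close>).\<close>

lemma words_UN:
  "(\<Union>w\<in>vicsek_words l n. vicsek_word_map l n w ` A) = (\<Union>w\<in>words n. (\<lambda>z. centre n w + z / of_real (L n)) ` A)"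
    (is "?L = ?R")
proof (intro equalityI subsetI)
  fix x assume "x \<in> ?L"
  then obtain w z where w: "w \<in> vicsek_words l n" "z \<in> A" "x = vicsek_word_map l n w z" by blast
  let ?v = "restrict (\<lambda>k. w (Suc k)) {0..<n}"
  have "?v \<in> words n" using w(1) by (auto simp: words_def vicsek_words_def S_def PiE_iff)
  moreover have "x = centre n ?v + z / of_real (L n)"
    unfolding w(3) word_map_eq by (auto intro!: centre_cong)
  ultimately show "x \<in> ?R" using w(2) by blast
next
  fix x assume "x \<in> ?R"
  then obtain v z where v: "v \<in> words n" "z \<in> A" "x = centre n v + z / of_real (L n)" by blast
  let ?w = "restrict (\<lambda>k. v (k - 1)) {1..n}"
  have "v (k - 1) \<in> vicsek_shifts (l k)" if "k \<in> {1..n}" for k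
  proof -
    have "v (k - 1) \<in> S (k - 1)" using v(1) that by (auto simp: words_def PiE_iff)
    then show ?thesis using that by (simp add: S_def)
  qed
  then have "?w \<in> vicsek_words l n" by (auto simp: vicsek_words_def)
  moreover have "x = vicsek_word_map l n ?w z"
    unfolding v(3) word_map_eq by (auto intro!: centre_cong)
  ultimately show "x \<in> ?L" using v(2) by blast
qed

lemma vertices_eq: "vicsek_vertices l n = {vertex n w j | w j. w \<in> words n \<and> j \<in> {0..4}}"
  unfolding vicsek_vertices_def words_UN vertex_def by blast

lemma vertex_0 [simp]: "vertex n w 0 = centre n w"
  by (simp add: vertex_def vicsek_pt_def)

section \<open>Gaussian integer coordinates of vertices\<close>

text \<open>After multiplication by \<open>L (Suc n)\<close>, the new letter contributes
  \<open>2 * m\<close> times a corner direction, and the earlier centre is multiplied by the integer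
  \<open>l (Suc n)\<close>; both contributions have even coordinates.\<close>

lemma centre_lattice:
  assumes "\<And>k. k < n \<Longrightarrow> w k \<in> S k"
  shows "\<exists>a b::int. of_real (L n) * centre n w = vicsek_pt 1 * Complex (2 * of_int a) (2 * of_int b)"
  using assms
proof (induction n)
  case 0
  show ?case by (rule exI[of _ 0], rule exI[of _ 0]) (simp add: complex_eq_iff)
next
  case (Suc n)
  then obtain a b where ab: "of_real (L n) * centre n w = vicsek_pt 1 * Complex (2 * of_int a) (2 * of_int b)"
    by (metis less_SucI)
  obtain m j where s: "w n = of_real (2 * real m / real (l (Suc n))) * vicsek_pt j" "j \<in> {1..4}"
    using Suc.prems[of n] unfolding S_eq by blast
  have "\<exists>c d::int. \<i> ^ (j - 1) = Complex (of_int c) (of_int d)"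
    using s(2) unfolding atLeastAtMost_1_4
  proof (elim insertE)
    assume "j = 1" then show ?thesis by (intro exI[of _ 1] exI[of _ 0]) (auto simp: complex_eq_iff)
  next
    assume "j = 2" then show ?thesis by (intro exI[of _ 0] exI[of _ 1]) (auto simp: complex_eq_iff)
  next
    assume "j = 3" then show ?thesis by (intro exI[of _ "-1"] exI[of _ 0]) (auto simp: complex_eq_iff)
  next
    assume "j = 4" then show ?thesis
      by (intro exI[of _ 0] exI[of _ "-1"]) (auto simp: complex_eq_iff power3_eq_cube)
  qed simp
  then obtain c d :: int where cd: "\<i> ^ (j - 1) = Complex (of_int c) (of_int d)" by blast
  have "l (Suc n) \<noteq> 0" using l_ge[of n] by simp
  then have "of_real (L (Suc n)) * centre (Suc n) w
      = of_nat (l (Suc n)) * (of_real (L n) * centre n w) + of_real (2 * real m) * vicsek_pt j"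
    by (simp add: L_Suc centre_Suc s(1) field_simps)
  also have "\<dots> = vicsek_pt 1 * (of_nat (l (Suc n)) * Complex (2 * of_int a) (2 * of_int b)
      + of_real (2 * real m) * Complex (of_int c) (of_int d))"
    unfolding ab vicsek_pt_eq[OF s(2)] cd by (simp add: algebra_simps)
  also have "of_nat (l (Suc n)) * Complex (2 * of_int a) (2 * of_int b) + of_real (2 * real m) * Complex (of_int c) (of_int d)
      = Complex (2 * of_int (int (l (Suc n)) * a + int m * c)) (2 * of_int (int (l (Suc n)) * b + int m * d))"
    by (simp add: complex_eq_iff algebra_simps)
  finally show ?case by blast
qed

lemma norm_lattice: "norm (vicsek_pt 1 * Complex (of_int a) (of_int b)) ^ 2 = of_int (a\<^sup>2 + b\<^sup>2)"
  using norm_vicsek_pt[of 1] by (simp add: norm_mult cmod_power2)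

text \<open>By evenness, different centres of level n are at least 2 apart after multiplication by
  \<open>L n\<close>, while two letters differ by less than 2. The last letter therefore cannot
  compensate for different centres of the prefixes.\<close>

lemma centre_inj:
  assumes "\<And>k. k < n \<Longrightarrow> w k \<in> S k" "\<And>k. k < n \<Longrightarrow> v k \<in> S k" "centre n w = centre n v" "k < n"
  shows "w k = v k"
  using assms
proof (induction n)
  case (Suc n)
  obtain a b where ab: "of_real (L n) * centre n w = vicsek_pt 1 * Complex (2 * of_int a) (2 * of_int b)"
    using centre_lattice[of n w] Suc.prems(1) by (metis less_SucI)
  obtain c d where cd: "of_real (L n) * centre n v = vicsek_pt 1 * Complex (2 * of_int c) (2 * of_int d)"
    using centre_lattice[of n v] Suc.prems(2) by (metis less_SucI)
  have eq: "of_real (L n) * centre n w - of_real (L n) * centre n v = v n - w n"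
    using Suc.prems(3) by (simp add: centre_Suc field_simps)
  have "vicsek_pt 1 * Complex (of_int (2 * (a - c))) (of_int (2 * (b - d))) = v n - w n"
    unfolding eq[symmetric] ab cd by (simp add: complex_eq_iff algebra_simps)
  moreover have "norm (v n - w n) < 2"
  proof -
    have "1 / real (l (Suc n)) > 0" using l_ge[of n] by simp
    moreover have "norm (w n) \<le> 1 - 1 / real (l (Suc n))" "norm (v n) \<le> 1 - 1 / real (l (Suc n))"
      by (simp_all add: norm_S Suc.prems(1,2))
    ultimately show ?thesis using norm_triangle_ineq4[of "v n" "w n"] by linarith
  qed
  ultimately have "norm (vicsek_pt 1 * Complex (of_int (2 * (a - c))) (of_int (2 * (b - d)))) ^ 2 < 2 ^ 2"
    by (intro power_strict_mono) auto
  then have "real_of_int ((2 * (a - c))\<^sup>2 + (2 * (b - d))\<^sup>2) < real_of_int 4"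
    unfolding norm_lattice by simp
  then have "(2 * (a - c))\<^sup>2 + (2 * (b - d))\<^sup>2 < 4" by (simp only: of_int_less_iff)
  then have "(a - c)\<^sup>2 + (b - d)\<^sup>2 < 1" by (simp add: power2_eq_square algebra_simps)
  moreover have "(a - c)\<^sup>2 \<ge> 0" "(b - d)\<^sup>2 \<ge> 0" by auto
  ultimately have "(a - c)\<^sup>2 = 0" "(b - d)\<^sup>2 = 0" by linarith+
  then have "a = c" "b = d" by auto
  then have "of_real (L n) * centre n w = of_real (L n) * centre n v" using ab cd by simp
  then have "centre n w = centre n v" by simp
  then show ?case using Suc eq by (cases "k = n") auto
qed simp

text \<open>
  Rotated by \<open>vicsek_pt 1\<close> and rescaled, the vertices are Gaussian integers: centres have two even
  coordinates and corners an odd coordinate sum.  This parity is why two vertices at distance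
  \<open>1 / L n\<close> are always the centre and a corner of one cell.
\<close>

definition lattice_coords :: "nat \<Rightarrow> complex \<Rightarrow> int \<Rightarrow> int \<Rightarrow> bool" where
  "lattice_coords n x a b \<longleftrightarrow> of_real (L n) * x = vicsek_pt 1 * Complex (of_int a) (of_int b)"

lemma lattice_coords_centre:
  assumes "w \<in> words n"
  obtains a b where "lattice_coords n (centre n w) a b" "even a" "even b"
proof -
  obtain a b :: int where "of_real (L n) * centre n w = vicsek_pt 1 * Complex (2 * of_int a) (2 * of_int b)"
    using centre_lattice[of n w] assms by (auto simp: words_def PiE_iff)
  then have "lattice_coords n (centre n w) (2 * a) (2 * b)" by (simp add: lattice_coords_def)
  then show ?thesis using that by simp
qed

lemma lattice_coords_vertex:
  assumes "w \<in> words n" "j \<in> {1..4}"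
  obtains a b where "lattice_coords n (vertex n w j) a b" "odd (a + b)"
proof -
  obtain a b where ab: "lattice_coords n (centre n w) a b" "even a" "even b" by (rule lattice_coords_centre[OF assms(1)])
  have *: "of_real (L n) * vertex n w j = vicsek_pt 1 * (Complex (of_int a) (of_int b) + \<i> ^ (j - 1))"
    using ab(1) unfolding lattice_coords_def vertex_def vicsek_pt_eq[OF assms(2)]
    by (simp add: field_simps)
  have "\<exists>c d. lattice_coords n (vertex n w j) c d \<and> odd (c + d)"
    using assms(2) unfolding atLeastAtMost_1_4
  proof (elim insertE)
    assume "j = 1" then show ?thesis using * ab(2,3)
      by (intro exI[of _ "a + 1"] exI[of _ b]) (simp add: lattice_coords_def complex_eq_iff)
  next
    assume "j = 2" then show ?thesis using * ab(2,3)
      by (intro exI[of _ a] exI[of _ "b + 1"]) (simp add: lattice_coords_def complex_eq_iff)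
  next
    assume "j = 3" then show ?thesis using * ab(2,3)
      by (intro exI[of _ "a - 1"] exI[of _ b]) (simp add: lattice_coords_def complex_eq_iff)
  next
    assume "j = 4" then show ?thesis using * ab(2,3)
      by (intro exI[of _ a] exI[of _ "b - 1"]) (simp add: lattice_coords_def complex_eq_iff power3_eq_cube)
  qed simp
  then show ?thesis using that by blast
qed

lemma lattice_coords_dist:
  assumes "lattice_coords n x a b" "lattice_coords n y c d"
  shows "dist x y = inverse (L n) \<longleftrightarrow> (a - c)\<^sup>2 + (b - d)\<^sup>2 = 1"
proof -
  have "L n * dist x y = norm (of_real (L n) * (x - y))"
    by (simp add: norm_mult dist_norm abs_of_pos[OF L_pos])
  also have "of_real (L n) * (x - y) = vicsek_pt 1 * Complex (of_int (a - c)) (of_int (b - d))"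
    using assms unfolding lattice_coords_def by (simp add: algebra_simps complex_eq_iff)
  finally have *: "(L n * dist x y)\<^sup>2 = of_int ((a - c)\<^sup>2 + (b - d)\<^sup>2)"
    by (simp only: norm_lattice)
  have "dist x y = inverse (L n) \<longleftrightarrow> L n * dist x y = 1"
    by (simp add: field_simps)
  also have "\<dots> \<longleftrightarrow> (L n * dist x y)\<^sup>2 = 1"
  proof -
    have "0 \<le> L n * dist x y" by (simp add: less_imp_le)
    then show ?thesis unfolding power2_eq_1_iff by linarith
  qed
  also have "\<dots> \<longleftrightarrow> (a - c)\<^sup>2 + (b - d)\<^sup>2 = 1"
    unfolding * by (metis of_int_1 of_int_eq_iff)
  finally show ?thesis .
qed

lemma lattice_coords_unique: "lattice_coords n x a b \<Longrightarrow> lattice_coords n x c d \<Longrightarrow> a = c \<and> b = d"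
proof -
  assume "lattice_coords n x a b" "lattice_coords n x c d"
  then have "vicsek_pt 1 * Complex (of_int a) (of_int b) = vicsek_pt 1 * Complex (of_int c) (of_int d)"
    by (metis lattice_coords_def)
  then have "Complex (of_int a) (of_int b) = Complex (of_int c) (of_int d)"
    using vicsek_pt_nz[of 1] by (metis atLeastAtMost_iff mult_left_cancel one_le_numeral order_refl)
  then show ?thesis by simp
qed

lemma sum_squares_int_eq_1:
  fixes x y :: int
  assumes "x\<^sup>2 + y\<^sup>2 = 1"
  shows "(x, y) \<in> {(1, 0), (0, 1), (-1, 0), (0, -1)}"
proof -
  have "x\<^sup>2 \<le> 1" "y\<^sup>2 \<le> 1" using assms zero_le_power2[of x] zero_le_power2[of y] by linarith+
  then have "\<bar>x\<bar> \<le> 1" "\<bar>y\<bar> \<le> 1" by (simp_all add: abs_square_le_1)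
  then have "x \<in> {-1, 0, 1}" "y \<in> {-1, 0, 1}" by auto
  then show ?thesis using assms by auto
qed

text \<open>Every vertex has integer coordinates, so at rescaled distance 1 the displacement is one
  of the four Gaussian units, and these are exactly the corner directions of the cell around the
  centre.\<close>

lemma neighbour_of_centre:
  assumes w: "w \<in> words n" and y: "y \<in> vicsek_vertices l n" and d: "dist (centre n w) y = inverse (L n)"
  shows "\<exists>j\<in>{1..4}. y = vertex n w j"
proof -
  obtain a b where ab: "lattice_coords n (centre n w) a b" "even a" "even b" by (rule lattice_coords_centre[OF w])
  have "\<exists>c d. lattice_coords n y c d"
  proof -
    obtain v j where v: "y = vertex n v j" "v \<in> words n" "j \<in> {0..4}" using y unfolding vertices_eq by blast
    then show ?thesis
    proof (cases "j = 0")
      case True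
      with v show ?thesis using lattice_coords_centre[OF v(2)] by (metis vertex_0)
    next
      case False
      then have "j \<in> {1..4}" using v(3) by auto
      with v show ?thesis using lattice_coords_vertex[OF v(2)] by metis
    qed
  qed
  then obtain c d where cd: "lattice_coords n y c d" by blast
  have "(c - a)\<^sup>2 + (d - b)\<^sup>2 = 1"
    using d lattice_coords_dist[OF ab(1) cd] by (simp add: power2_commute)
  from sum_squares_int_eq_1[OF this] have "\<exists>j\<in>{1..4}. \<i> ^ (j - 1) = Complex (of_int (c - a)) (of_int (d - b))"
    unfolding atLeastAtMost_1_4 by (auto simp: complex_eq_iff power2_eq_square power3_eq_cube)
  then obtain j where j: "j \<in> {1..4}" "\<i> ^ (j - 1) = Complex (of_int (c - a)) (of_int (d - b))" by blast
  have "of_real (L n) * vertex n w j = of_real (L n) * centre n w + vicsek_pt j"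
    by (simp add: vertex_def distrib_left)
  also have "\<dots> = vicsek_pt 1 * (Complex (of_int a) (of_int b) + Complex (of_int (c - a)) (of_int (d - b)))"
    using ab(1) unfolding lattice_coords_def vicsek_pt_eq[OF j(1)] j(2) by (simp add: distrib_left)
  also have "Complex (of_int a) (of_int b) + Complex (of_int (c - a)) (of_int (d - b)) = Complex (of_int c) (of_int d)"
    by (simp add: complex_eq_iff)
  also have "vicsek_pt 1 * \<dots> = of_real (L n) * y" using cd unfolding lattice_coords_def by simp
  finally have "of_real (L n) * y = of_real (L n) * vertex n w j" by simp
  then show ?thesis using j(1) by auto
qed

section \<open>Edges as centre-corner pairs of cells\<close>

definition ends :: "nat \<Rightarrow> (nat \<Rightarrow> complex) \<times> nat \<Rightarrow> complex \<times> complex" where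
  "ends n = (\<lambda>(w, j). (centre n w, vertex n w j))"

lemma adj_eq: "vicsek_adj l n = ends n ` (words n \<times> {1..4}) \<union> prod.swap ` ends n ` (words n \<times> {1..4})"
proof -
  have dL: "(\<Prod>j=0..n. inverse (real (l j))) = inverse (L n)"
    unfolding L_def by (rule prod_inversef[unfolded o_def])
  have edge: "dist (centre n w) (vertex n w j) = inverse (L n)" if "j \<in> {1..4}" for w j
    using norm_vicsek_pt[OF that]
    by (simp add: vertex_def dist_norm norm_divide inverse_eq_divide abs_of_pos[OF L_pos])
  have vert: "centre n w \<in> vicsek_vertices l n" "j \<in> {1..4} \<Longrightarrow> vertex n w j \<in> vicsek_vertices l n"
    if "w \<in> words n" for w j
    using that vertex_0[of n w, symmetric] unfolding vertices_eq by force+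
  show ?thesis
  proof (intro equalityI subsetI)
    fix e assume e: "e \<in> vicsek_adj l n"
    obtain x y where xy: "e = (x, y)" by (cases e)
    have x: "x \<in> vicsek_vertices l n" "y \<in> vicsek_vertices l n" "dist x y = inverse (L n)"
      using e unfolding vicsek_adj_def dL xy by auto
    obtain w i where w: "x = vertex n w i" "w \<in> words n" "i \<in> {0..4}" using x(1) unfolding vertices_eq by blast
    obtain v j where v: "y = vertex n v j" "v \<in> words n" "j \<in> {0..4}" using x(2) unfolding vertices_eq by blast
    consider "i = 0" | "j = 0" | "i \<in> {1..4}" "j \<in> {1..4}" using w(3) v(3) by fastforce
    then show "e \<in> ends n ` (words n \<times> {1..4}) \<union> prod.swap ` ends n ` (words n \<times> {1..4})"
    proof cases
      case 1
      then obtain k where "k \<in> {1..4}" "y = vertex n w k"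
        using neighbour_of_centre[OF w(2) x(2)] x(3) w(1) by auto
      then have "e = ends n (w, k)" "(w, k) \<in> words n \<times> {1..4}" using w 1 xy by (auto simp: ends_def)
      then show ?thesis by blast
    next
      case 2
      then obtain k where "k \<in> {1..4}" "x = vertex n v k"
        using neighbour_of_centre[OF v(2) x(1)] x(3) v(1) by (auto simp: dist_commute)
      then have "e = prod.swap (ends n (v, k))" "(v, k) \<in> words n \<times> {1..4}" using v 2 xy by (auto simp: ends_def)
      then show ?thesis by blast
    next
      \<comment> \<open>Two corners have odd coordinate sums, so the square of their rescaled
        distance is even and cannot be 1.\<close>
      case 3
      obtain a b where ab: "lattice_coords n x a b" "odd (a + b)" using lattice_coords_vertex[OF w(2) 3(1)] w(1) by metis
      obtain c d where cd: "lattice_coords n y c d" "odd (c + d)" using lattice_coords_vertex[OF v(2) 3(2)] v(1) by metis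
      have "(a - c)\<^sup>2 + (b - d)\<^sup>2 = 1" using x(3) lattice_coords_dist[OF ab(1) cd(1)] by simp
      then have "odd ((a - c)\<^sup>2 + (b - d)\<^sup>2)" by simp
      then show ?thesis using ab(2) cd(2) by auto
    qed
  next
    fix e assume "e \<in> ends n ` (words n \<times> {1..4}) \<union> prod.swap ` ends n ` (words n \<times> {1..4})"
    then show "e \<in> vicsek_adj l n"
      using vert edge unfolding vicsek_adj_def dL by (auto simp: ends_def dist_commute)
  qed
qed

lemma inj_ends: "inj_on (ends n) (words n \<times> {1..4})"
proof (rule inj_onI, clarify)
  fix w i v j assume w: "w \<in> words n" "v \<in> words n" "i \<in> {1..4}" "j \<in> {1..4}" and e: "ends n (w, i) = ends n (v, j)"
  have c: "centre n w = centre n v" using e by (simp add: ends_def)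
  have "w k = v k" for k
    using centre_inj[OF _ _ c, of k] w(1,2) PiE_arb[OF w(1)[unfolded words_def], of k] PiE_arb[OF w(2)[unfolded words_def], of k]
    by (cases "k < n") (auto simp: words_def PiE_iff)
  moreover have "vicsek_pt i = vicsek_pt j" using e c by (simp add: ends_def vertex_def)
  then have "i = j" using inj_vicsek_pt w(3,4) by (auto dest: inj_onD)
  ultimately show "w = v \<and> i = j" by auto
qed

lemma finite_words: "finite (words n)"
  unfolding words_def using finite_S by (intro finite_PiE) auto

definition cell_energy :: "(complex \<Rightarrow> real) \<Rightarrow> nat \<Rightarrow> (nat \<Rightarrow> complex) \<Rightarrow> real" where
  "cell_energy u n w = L n powr (p - 1) * (\<Sum>j\<in>{1..4}. \<bar>u (vertex n w j) - u (centre n w)\<bar> powr p)"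

text \<open>Each edge joins the centre of exactly one cell to one of its corners, and the factor 1/2
  of the energy cancels the two orientations.\<close>

lemma energy_n_eq: "energy_n l p n u = (\<Sum>w\<in>words n. cell_energy u n w)"
proof -
  let ?D = "words n \<times> {1..4::nat}"
  let ?f = "\<lambda>(x, y). \<bar>u x - u y\<bar> powr p"
  have fin: "finite ?D" using finite_words by simp
  \<comment> \<open>A centre has an even coordinate sum and a corner an odd one, so no centre-corner
    pair is also a corner-centre pair.\<close>
  have disj: "ends n ` ?D \<inter> prod.swap ` ends n ` ?D = {}"
  proof (rule ccontr)
    assume "\<not> ?thesis"
    then obtain e f where "e \<in> ?D" "f \<in> ?D" "ends n e = prod.swap (ends n f)" by blast
    then obtain w i v j where w: "w \<in> words n" "i \<in> {1..4}" "v \<in> words n" "j \<in> {1..4}"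
      "ends n (w, i) = prod.swap (ends n (v, j))" by (cases e, cases f) auto
    then have eq: "centre n w = vertex n v j" by (simp add: ends_def)
    obtain a b where ab: "lattice_coords n (centre n w) a b" "even a" "even b" by (rule lattice_coords_centre[OF w(1)])
    obtain c d where cd: "lattice_coords n (centre n w) c d" "odd (c + d)" using lattice_coords_vertex[OF w(3,4)] eq by metis
    show False using lattice_coords_unique[OF ab(1) cd(1)] ab(2,3) cd(2) by auto
  qed
  have "(\<Sum>e\<in>vicsek_adj l n. ?f e) = (\<Sum>e\<in>ends n ` ?D. ?f e) + (\<Sum>e\<in>prod.swap ` ends n ` ?D. ?f e)"
    unfolding adj_eq using fin by (intro sum.union_disjoint disj) auto
  also have "(\<Sum>e\<in>prod.swap ` ends n ` ?D. ?f e) = (\<Sum>e\<in>ends n ` ?D. ?f e)"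
    by (subst sum.reindex) (auto intro!: sum.cong simp: abs_minus_commute split: prod.splits)
  also have "(\<Sum>e\<in>ends n ` ?D. ?f e) = (\<Sum>e\<in>?D. ?f (ends n e))"
    by (subst sum.reindex[OF inj_ends]) simp
  also have "\<dots> = (\<Sum>w\<in>words n. \<Sum>j\<in>{1..4}. \<bar>u (vertex n w j) - u (centre n w)\<bar> powr p)"
    by (simp add: sum.cartesian_product ends_def split_def abs_minus_commute)
  finally have s: "(\<Sum>e\<in>vicsek_adj l n. ?f e) = 2 * (\<Sum>w\<in>words n. \<Sum>j\<in>{1..4}. \<bar>u (vertex n w j) - u (centre n w)\<bar> powr p)"
    by simp
  have "(\<Prod>j=0..n. real (l j) powr (p - 1)) = L n powr (p - 1)"
    unfolding L_def by (rule prod_powr_distrib[symmetric])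
  then show ?thesis unfolding energy_n_def s by (simp add: cell_energy_def sum_distrib_left)
qed

section \<open>Local energies\<close>

text \<open>Hoelder along an arm of \<open>N\<close> pieces costs \<open>N powr (p - 1)\<close>,
  exactly the quotient of the energy prefactors of levels \<open>n + 1\<close> and \<open>n\<close>.
  The four arms occupy \<open>4 * N\<close> of the fine edges, and the remaining edges only increase
  the sum. No letter of \<open>w\<close> is restricted, which matches the quantifiers in
  \<open>mass\<close>.\<close>

lemma cell_energy_le_sum: "cell_energy u n w \<le> (\<Sum>s\<in>S n. cell_energy u (Suc n) (w(n := s)))"
proof -
  define N where "N = l (Suc n)"
  have N: "N = 2 * half n + 1" "N > 0" using l_eq[of n] by (auto simp: N_def)
  define c where "c = centre n w"
  define D where "D = (\<lambda>(s, k). \<bar>u (vertex (Suc n) (w(n := s)) k) - u (centre (Suc n) (w(n := s)))\<bar> powr p)"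
  \<comment> \<open>Equally spaced points on arm j, ending at the corner for \<open>i = N\<close>.
    For \<open>i < N\<close>, an even i gives the centre of a fine cell and an odd i the corner
    shared by two consecutive fine cells.\<close>
  define z where "z j i = c + of_real (real i / real N) * vicsek_pt j / of_real (L n)" for j i
  \<comment> \<open>the cell and the arm covering the \<open>i\<close>-th piece of the \<open>j\<close>-th arm of the coarse cell\<close>
  define \<phi> where "\<phi> = (\<lambda>(j, i). (of_real (2 * real ((i + 1) div 2) / real N) * vicsek_pt j, if even i then j else opposite j))"
  have cen: "centre (Suc n) (w(n := s)) = c + s / of_real (L n)" for s
    by (simp add: centre_Suc c_def)
  have ver: "vertex (Suc n) (w(n := s)) k = c + s / of_real (L n) + vicsek_pt k / of_real (real N) / of_real (L n)" for s k
    using N by (simp add: vertex_def cen L_Suc N_def field_simps)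
  have step: "\<bar>u (z j (Suc i)) - u (z j i)\<bar> powr p = D (\<phi> (j, i))" if "j \<in> {1..4}" for i j
  proof (cases "even i")
    case True
    then obtain m where i: "i = 2 * m" by blast
    have "z j i = centre (Suc n) (w(n := of_real (2 * real m / real N) * vicsek_pt j))"
      unfolding cen z_def i by simp
    moreover have "z j (Suc i) = vertex (Suc n) (w(n := of_real (2 * real m / real N) * vicsek_pt j)) j"
      unfolding ver z_def i by (simp add: add_divide_distrib distrib_right)
    ultimately show ?thesis by (simp add: D_def \<phi>_def i)
  next
    case False
    then obtain m where i: "i = 2 * m + 1" by (auto elim: oddE)
    have "z j (Suc i) = centre (Suc n) (w(n := of_real (2 * real (Suc m) / real N) * vicsek_pt j))"
      unfolding cen z_def i by simp
    moreover have "z j i = vertex (Suc n) (w(n := of_real (2 * real (Suc m) / real N) * vicsek_pt j)) (opposite j)"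
      unfolding ver z_def i opposite(2)[OF that] by (simp add: add_divide_distrib distrib_right)
    ultimately show ?thesis by (simp add: D_def \<phi>_def i abs_minus_commute)
  qed
  have arm: "\<bar>u (vertex n w j) - u c\<bar> powr p \<le> real N powr (p - 1) * (\<Sum>i<N. D (\<phi> (j, i)))" if j: "j \<in> {1..4}" for j
  proof -
    have "vertex n w j = z j N" "c = z j 0"
      using N by (simp_all add: z_def vertex_def c_def)
    then have "u (vertex n w j) - u c = (\<Sum>i<N. u (z j (Suc i)) - u (z j i))"
      by (simp only: sum_lessThan_telescope[of "\<lambda>i. u (z j i)" N])
    then have "\<bar>u (vertex n w j) - u c\<bar> powr p \<le> real N powr (p - 1) * (\<Sum>i<N. \<bar>u (z j (Suc i)) - u (z j i)\<bar> powr p)"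
      using powr_abs_sum_le[OF p] by simp
    then show ?thesis by (simp only: step[OF j])
  qed
  have inj: "inj_on \<phi> ({1..4} \<times> {..<N})"
  proof (rule inj_onI, clarify)
    fix i j i' j' :: nat
    assume j: "j \<in> {1..4}" "j' \<in> {1..4}" and e: "\<phi> (j, i) = \<phi> (j', i')"
    define m where "m = (i + 1) div 2"
    define m' where "m' = (i' + 1) div 2"
    have s: "of_real (2 * real m / real N) * vicsek_pt j = of_real (2 * real m' / real N) * vicsek_pt j'"
      and k: "(if even i then j else opposite j) = (if even i' then j' else opposite j')"
      using e by (simp_all add: \<phi>_def m_def m'_def)
    have "norm (complex_of_real (2 * real m / real N) * vicsek_pt j) = norm (complex_of_real (2 * real m' / real N) * vicsek_pt j')"
      by (simp only: s)
    then have "2 * real m / real N = 2 * real m' / real N"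
      unfolding norm_mult norm_vicsek_pt[OF j(1)] norm_vicsek_pt[OF j(2)] norm_of_real by simp
    then have m: "m = m'" using N by simp
    \<comment> \<open>All four arms pass through the central fine cell, whose letter 0 does not
      reveal j. There i is 0, and the corner index itself identifies the arm.\<close>
    have "j = j'"
    proof (cases "m = 0")
      case True
      then have "i = 0" "i' = 0" using m by (auto simp: m_def m'_def)
      then show ?thesis using k by simp
    next
      case False
      then have "complex_of_real (2 * real m / real N) \<noteq> 0" using N(2) by simp
      then have "vicsek_pt j = vicsek_pt j'" using s unfolding m[symmetric] mult_cancel_left by blast
      then show ?thesis using inj_vicsek_pt j by (auto dest: inj_onD)
    qed
    moreover have ev: "even i \<longleftrightarrow> even i'" using k opposite(3)[OF j(1)] unfolding \<open>j = j'\<close>[symmetric] by (simp split: if_splits)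
    have "(i + 1) div 2 = (i' + 1) div 2" using m unfolding m_def m'_def .
    with ev have "i = i'" by presburger
    ultimately show "j = j' \<and> i = i'" by simp
  qed
  have im: "\<phi> ` ({1..4} \<times> {..<N}) \<subseteq> S n \<times> {1..4}"
  proof (rule subsetI)
    fix e assume "e \<in> \<phi> ` ({1..4} \<times> {..<N})"
    then obtain j i where j: "j \<in> {1..4}" and i: "i < N" and e: "e = \<phi> (j, i)" by auto
    have "(i + 1) div 2 \<le> half n" using i N(1) by auto
    then have "fst e \<in> S n" using S_memI[of "(i + 1) div 2" n j] j e by (simp add: \<phi>_def N_def)
    moreover have "snd e \<in> {1..4}" using j opposite(1)[OF j] e by (auto simp: \<phi>_def)
    ultimately show "e \<in> S n \<times> {1..4}" by (simp add: mem_Times_iff)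
  qed
  have "(\<Sum>j\<in>{1..4}. \<bar>u (vertex n w j) - u c\<bar> powr p) \<le> (\<Sum>j\<in>{1..4}. real N powr (p - 1) * (\<Sum>i<N. D (\<phi> (j, i))))"
    by (rule sum_mono) (rule arm)
  also have "\<dots> = real N powr (p - 1) * (\<Sum>ji\<in>{1..4} \<times> {..<N}. D (\<phi> ji))"
    by (simp add: sum_distrib_left[symmetric] sum.cartesian_product split_def)
  also have "(\<Sum>ji\<in>{1..4} \<times> {..<N}. D (\<phi> ji)) = (\<Sum>e\<in>\<phi> ` ({1..4} \<times> {..<N}). D e)"
    by (subst sum.reindex[OF inj]) simp
  also have "\<dots> \<le> (\<Sum>e\<in>S n \<times> {1..4}. D e)"
    using im finite_S[of n] by (intro sum_mono2) (auto simp: D_def)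
  finally have "cell_energy u n w \<le> L n powr (p - 1) * (real N powr (p - 1) * (\<Sum>e\<in>S n \<times> {1..4}. D e))"
    unfolding cell_energy_def c_def by (simp add: mult_left_mono)
  also have "\<dots> = L (Suc n) powr (p - 1) * (\<Sum>e\<in>S n \<times> {1..4}. D e)"
    by (simp add: L_Suc N_def powr_mult less_imp_le)
  also have "\<dots> = (\<Sum>s\<in>S n. cell_energy u (Suc n) (w(n := s)))"
    by (simp add: cell_energy_def D_def sum.cartesian_product sum_distrib_left split_def)
  finally show ?thesis .
qed

section \<open>Sums over refinements and their limits\<close>

text \<open>The sum of \<open>g (n + m)\<close> over the words of length \<open>n + m\<close>
  extending \<open>w\<close>. The recursion fixes the next letter first, so additivity over subcells
  is its defining equation and carries over to the limit in \<open>m\<close>.\<close>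

primrec refine :: "(nat \<Rightarrow> (nat \<Rightarrow> complex) \<Rightarrow> real) \<Rightarrow> nat \<Rightarrow> nat \<Rightarrow> (nat \<Rightarrow> complex) \<Rightarrow> real" where
  "refine g 0 n w = g n w"
| "refine g (Suc m) n w = (\<Sum>s\<in>S n. refine g m (Suc n) (w(n := s)))"

lemma refine_incr:
  assumes "\<And>n w. g n w \<le> (\<Sum>s\<in>S n. g (Suc n) (w(n := s)))"
  shows "refine g m n w \<le> refine g (Suc m) n w"
proof (induction m arbitrary: n w)
  case 0
  then show ?case using assms by simp
next
  case (Suc m)
  then show ?case by (subst (1 2) refine.simps(2)) (rule sum_mono)
qed

lemma refine_cong:
  assumes "\<And>n w w'. (\<And>k. k < n \<Longrightarrow> w k = w' k) \<Longrightarrow> g n w = g n w'" "\<And>k. k < n \<Longrightarrow> w k = w' k"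
  shows "refine g m n w = refine g m n w'"
  using assms(2)
proof (induction m arbitrary: n w w')
  case 0
  then have "g n w = g n w'" by (intro assms(1))
  then show ?case by simp
next
  case (Suc m)
  have "refine g m (Suc n) (w(n := s)) = refine g m (Suc n) (w'(n := s))" for s
    by (rule Suc.IH) (use Suc.prems in \<open>auto simp: less_Suc_eq\<close>)
  then show ?case by simp
qed

lemma sum_words_Suc: "(\<Sum>w\<in>words n. \<Sum>s\<in>S n. f (w(n := s))) = (\<Sum>w\<in>words (Suc n). f w :: real)"
proof -
  have "words (Suc n) = (\<lambda>(s, w). w(n := s)) ` (S n \<times> words n)"
    unfolding words_def atLeast0_lessThan_Suc by (rule PiE_insert_eq)
  moreover have "inj_on (\<lambda>(s, w). w(n := s)) (S n \<times> words n)"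
    unfolding words_def by (rule inj_combinator) simp
  ultimately have "(\<Sum>w\<in>words (Suc n). f w) = (\<Sum>(s, w)\<in>S n \<times> words n. f (w(n := s)))"
    by (simp add: sum.reindex split_def)
  also have "\<dots> = (\<Sum>s\<in>S n. \<Sum>w\<in>words n. f (w(n := s)))"
    by (simp add: sum.cartesian_product)
  finally show ?thesis by (subst sum.swap) simp
qed

lemma refine_total: "(\<Sum>w\<in>words n. refine g m n w) = (\<Sum>w\<in>words (n + m). g (n + m) w)"
proof (induction m arbitrary: n)
  case (Suc m)
  then show ?case using Suc[of "Suc n"] by (simp add: sum_words_Suc)
qed simp

lemma words_0: "words 0 = {\<lambda>_. undefined}"
  by (simp add: words_def)

lemma energy_n_refine: "energy_n l p n u = refine (cell_energy u) n 0 (\<lambda>_. undefined)"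
  using refine_total[of "cell_energy u" n 0] by (simp add: energy_n_eq words_0)

lemma cell_energy_cong: "(\<And>k. k < n \<Longrightarrow> w k = w' k) \<Longrightarrow> cell_energy u n w = cell_energy u n w'"
  using centre_cong[of n w w'] by (simp add: cell_energy_def vertex_def)

lemma refine_energy_mono: "i \<le> j \<Longrightarrow> refine (cell_energy u) i n w \<le> refine (cell_energy u) j n w"
  by (rule lift_Suc_mono_le[of "\<lambda>m. refine (cell_energy u) m n w"]) (rule refine_incr[OF cell_energy_le_sum])

text \<open>A monotone limit, by \<open>refine_energy_mono\<close>. Values in \<open>ennreal\<close>
  give it a meaning for every \<open>u\<close> and let the supremum commute with finite
  sums.\<close>

definition local_energy :: "(complex \<Rightarrow> real) \<Rightarrow> nat \<Rightarrow> (nat \<Rightarrow> complex) \<Rightarrow> ennreal" where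
  "local_energy u n w = (SUP m. ennreal (refine (cell_energy u) m n w))"

lemma cell_energy_nonneg: "0 \<le> cell_energy u n w"
  by (simp add: cell_energy_def sum_nonneg)

lemma refine_nonneg: "(\<And>n w. 0 \<le> g n w) \<Longrightarrow> 0 \<le> refine g m n w"
  by (induction m arbitrary: n w) (auto intro: sum_nonneg)

lemma local_energy_root:
  assumes "bdd_above (range (\<lambda>n. energy_n l p n u))"
  shows "local_energy u 0 w = ennreal (energy l p u)"
proof -
  \<comment> \<open>At level 0 every sequence stands for the empty word, which
    \<open>words 0\<close> represents by \<open>\<lambda>_. undefined\<close>.\<close>
  have "refine (cell_energy u) m 0 w = energy_n l p m u" for m
    unfolding energy_n_refine by (intro refine_cong cell_energy_cong) auto
  then have "local_energy u 0 w = (SUP m. ennreal (energy_n l p m u))" by (simp add: local_energy_def)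
  also have "\<dots> = ennreal (energy l p u)"
  proof -
    have "(SUP m. ennreal (energy_n l p m u)) \<le> ennreal (energy l p u)"
      unfolding energy_def by (intro SUP_least ennreal_leI cSUP_upper assms) simp
    then have "(SUP m. ennreal (energy_n l p m u)) \<noteq> \<top>" by (metis ennreal_neq_top top_unique)
    then show ?thesis unfolding energy_def by (simp add: ennreal_SUP)
  qed
  finally show ?thesis .
qed

lemma mass_local_energy:
  assumes "bdd_above (range (\<lambda>n. energy_n l p n u))"
  shows "mass (local_energy u)"
  unfolding mass_def
proof (intro conjI allI impI)
  fix n and w w' :: "nat \<Rightarrow> complex" assume "\<forall>k<n. w k = w' k"
  then have "refine (cell_energy u) m n w = refine (cell_energy u) m n w'" for m
    by (intro refine_cong cell_energy_cong) auto
  then show "local_energy u n w = local_energy u n w'" by (simp add: local_energy_def)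
next
  fix n and w :: "nat \<Rightarrow> complex"
  have inc: "incseq (\<lambda>m. ennreal (refine (cell_energy u) m k v))" for k v
    by (intro monoI ennreal_leI refine_energy_mono)
  \<comment> \<open>Dropping the first term of an increasing sequence leaves its supremum unchanged;
    the shifted terms are sums over the next letter, and the supremum enters the finite sum because
    every summand increases.\<close>
  have "local_energy u n w = (SUP m. ennreal (refine (cell_energy u) (Suc m) n w))"
    unfolding local_energy_def
  proof (rule SUP_eq)
    fix m
    show "\<exists>k\<in>UNIV. ennreal (refine (cell_energy u) m n w) \<le> ennreal (refine (cell_energy u) (Suc k) n w)"
      by (rule bexI[of _ m]) (auto intro!: ennreal_leI refine_energy_mono simp del: refine.simps)
    show "\<exists>k\<in>UNIV. ennreal (refine (cell_energy u) (Suc m) n w) \<le> ennreal (refine (cell_energy u) k n w)"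
      by (rule bexI[of _ "Suc m"]) auto
  qed
  also have "\<dots> = (SUP m. \<Sum>s\<in>S n. ennreal (refine (cell_energy u) m (Suc n) (w(n := s))))"
    by (simp add: sum_ennreal refine_nonneg cell_energy_nonneg)
  also have "\<dots> = (\<Sum>s\<in>S n. local_energy u (Suc n) (w(n := s)))"
    unfolding local_energy_def using inc by (intro ennreal_SUP_sum) auto
  finally show "local_energy u n w = (\<Sum>s\<in>S n. local_energy u (Suc n) (w(n := s)))" .
next
  show "local_energy u 0 w < \<infinity>" for w
    unfolding local_energy_root[OF assms] by simp
qed

section \<open>Coding points of the Vicsek set by words\<close>

definition cell :: "nat \<Rightarrow> (nat \<Rightarrow> complex) \<Rightarrow> complex set" where
  "cell n w = (\<lambda>z. centre n w + z / of_real (L n)) ` vicsek_square"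

lemma cell_cong: "(\<And>k. k < n \<Longrightarrow> w k = w' k) \<Longrightarrow> cell n w = cell n w'"
  unfolding cell_def using centre_cong[of n w w'] by simp

lemma compact_cell: "compact (cell n w)"
  unfolding cell_def by (intro compact_continuous_image compact_vicsek_square continuous_intros) simp

lemma centre_in_cell: "centre n w \<in> cell n w"
  unfolding cell_def by (rule image_eqI[OF _ zero_vicsek_square]) simp

lemma vertex_in_cell: "j \<in> {0..4} \<Longrightarrow> vertex n w j \<in> cell n w"
proof (cases "j = 0")
  case False
  assume "j \<in> {0..4}"
  then have "vicsek_pt j \<in> vicsek_square" using False by (intro vicsek_square_pt) auto
  then show ?thesis unfolding cell_def vertex_def by blast
qed (simp add: centre_in_cell)

lemma dist_cell:
  assumes "x \<in> cell n w"
  shows "dist (centre n w) x \<le> 1 / L n"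
proof -
  obtain z where z: "z \<in> vicsek_square" "x = centre n w + z / of_real (L n)" using assms unfolding cell_def by blast
  then have "norm z \<le> 1" using vicsek_square_cball by auto
  then show ?thesis
    by (simp add: z(2) dist_norm norm_divide abs_of_pos[OF L_pos] divide_right_mono less_imp_le)
qed

text \<open>Since \<open>l (Suc n) - 1 = 2 * half n\<close>, the letter is \<open>1 - 1 / N\<close>
  times a point between 0 and a corner, where \<open>N\<close> is the subdivision number. The image
  point is thus a convex combination of two points of the square.\<close>

lemma shift_vicsek_square:
  assumes s: "s \<in> S n" and z: "z \<in> vicsek_square"
  shows "s + z / of_nat (l (Suc n)) \<in> vicsek_square"
proof -
  obtain m j where m: "s = of_real (2 * real m / real (l (Suc n))) * vicsek_pt j" "m \<le> half n" "j \<in> {1..4}"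
    using s unfolding S_eq by blast
  define N where "N = real (l (Suc n))"
  have N: "N = 2 * real (half n) + 1" "half n \<ge> 1" using half_pos by (simp_all add: N_def l_eq)
  have "(real m / real (half n)) *\<^sub>R vicsek_pt j + (1 - real m / real (half n)) *\<^sub>R 0 \<in> vicsek_square"
    using m N by (intro convexD[OF convex_vicsek_square] vicsek_square_pt zero_vicsek_square) auto
  then have "(1 - 1 / N) *\<^sub>R (real m / real (half n)) *\<^sub>R vicsek_pt j + (1 / N) *\<^sub>R z \<in> vicsek_square"
    using z N by (intro convexD[OF convex_vicsek_square]) auto
  moreover have "(1 - 1 / N) * (real m / real (half n)) = 2 * real m / N"
    using N(2) unfolding N(1) by (simp add: field_simps)
  then have "(1 - 1 / N) *\<^sub>R (real m / real (half n)) *\<^sub>R vicsek_pt j = s"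
    by (simp only: scaleR_scaleR) (simp add: m(1) N_def scaleR_conv_of_real)
  moreover have "(1 / N) *\<^sub>R z = z / of_nat (l (Suc n))" by (simp add: N_def scaleR_conv_of_real)
  ultimately show ?thesis by simp
qed

lemma cell_Suc_subset:
  assumes "w n \<in> S n"
  shows "cell (Suc n) w \<subseteq> cell n w"
proof
  fix x assume "x \<in> cell (Suc n) w"
  then obtain z where z: "z \<in> vicsek_square" "x = centre (Suc n) w + z / of_real (L (Suc n))"
    unfolding cell_def by blast
  have "x = centre n w + (w n + z / of_nat (l (Suc n))) / of_real (L n)"
    by (simp add: z(2) centre_Suc L_Suc add_divide_distrib)
  then show "x \<in> cell n w" using shift_vicsek_square[OF assms z(1)] unfolding cell_def by blast
qed

lemma cell_mono:
  assumes "n \<le> m" "\<And>k. k < m \<Longrightarrow> w k \<in> S k"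
  shows "cell m w \<subseteq> cell n w"
  using assms
proof (induction m rule: dec_induct)
  case (step m)
  then show ?case using cell_Suc_subset[of w m] by (meson less_SucI lessI order_trans)
qed simp

definition cells :: "nat \<Rightarrow> complex set" where
  "cells n = (\<Union>w\<in>words n. cell n w)"

lemma vicsek_set_eq: "vicsek_set l = (\<Inter>n\<in>{1..}. cells n)"
  unfolding vicsek_set_def words_UN cells_def cell_def ..

lemma words_Suc_restrict: "w \<in> words (Suc n) \<Longrightarrow> restrict w {0..<n} \<in> words n"
  by (auto simp: words_def PiE_iff)

lemma cells_Suc_subset: "cells (Suc n) \<subseteq> cells n"
proof
  fix x assume "x \<in> cells (Suc n)"
  then obtain w where w: "w \<in> words (Suc n)" "x \<in> cell (Suc n) w" unfolding cells_def by blast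
  have "w n \<in> S n" using w(1) by (auto simp: words_def PiE_iff)
  then have "x \<in> cell n w" using cell_Suc_subset w(2) by blast
  also have "cell n w = cell n (restrict w {0..<n})" by (rule cell_cong) simp
  finally show "x \<in> cells n" using words_Suc_restrict[OF w(1)] unfolding cells_def by blast
qed

lemma cells_mono: "n \<le> m \<Longrightarrow> cells m \<subseteq> cells n"
  by (rule lift_Suc_antimono_le) (rule cells_Suc_subset)

lemma compact_cells: "compact (cells n)"
  unfolding cells_def using finite_words compact_cell by (intro compact_UN) auto

lemma vicsek_set_subset: "vicsek_set l \<subseteq> cells n"
  using cells_mono[of n "Suc n"] unfolding vicsek_set_eq by fastforce

lemma vicsek_setI: "(\<And>n. x \<in> cells n) \<Longrightarrow> x \<in> vicsek_set l"
  unfolding vicsek_set_eq by blast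

lemma compact_vicsek_set: "compact (vicsek_set l)"
proof -
  have "closed (vicsek_set l)"
    unfolding vicsek_set_eq using compact_cells by (intro closed_INT) (auto intro: compact_imp_closed)
  moreover have "bounded (vicsek_set l)"
    using vicsek_set_subset[of 0] compact_cells compact_imp_bounded bounded_subset by blast
  ultimately show ?thesis by (simp add: compact_eq_bounded_closed)
qed

text \<open>A centre persists by appending the letter 0, corner j by appending the outermost letter
  in direction j: the identity \<open>2 * half n + 1 = l (Suc n)\<close> says that the last small
  cell reaches exactly to the corner.\<close>

lemma vertices_Suc: "vicsek_vertices l n \<subseteq> vicsek_vertices l (Suc n)"
proof
  fix x assume "x \<in> vicsek_vertices l n"
  then obtain w j where w: "x = vertex n w j" "w \<in> words n" "j \<in> {0..4}" unfolding vertices_eq by blast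
  have X: "w(n := s) \<in> words (Suc n)" if "s \<in> S n" for s
    using w(2) that by (auto simp: words_def PiE_iff extensional_def)
  show "x \<in> vicsek_vertices l (Suc n)"
  proof (cases "j = 0")
    case True
    then have "x = vertex (Suc n) (w(n := 0)) 0" using w(1) by (simp add: centre_Suc)
    then show ?thesis using X[OF zero_S] unfolding vertices_eq by force
  next
    case False
    then have j: "j \<in> {1..4}" using w(3) by auto
    define s where "s = complex_of_real (2 * real (half n) / real (l (Suc n))) * vicsek_pt j"
    have s: "s \<in> S n" unfolding s_def by (rule S_memI[OF order_refl j])
    have "s + vicsek_pt j / of_nat (l (Suc n)) = ((2 * of_nat (half n) + 1) / of_nat (l (Suc n))) * vicsek_pt j"
      by (simp add: s_def add_divide_distrib distrib_right)
    also have "\<dots> = vicsek_pt j"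
    proof -
      have "(2 * of_nat (half n) + 1 :: complex) = of_nat (l (Suc n))" by (simp add: l_eq)
      moreover have "of_nat (l (Suc n)) \<noteq> (0::complex)" using l_ge[of n] by simp
      ultimately show ?thesis by simp
    qed
    finally have "x = vertex (Suc n) (w(n := s)) j"
      unfolding w(1) by (simp add: vertex_def centre_Suc L_Suc add_divide_distrib[symmetric])
        (metis add_divide_distrib divide_divide_eq_left' )
    then show ?thesis using X[OF s] w(3) unfolding vertices_eq by blast
  qed
qed

lemma vertex_in_vicsek_set:
  assumes "w \<in> words n" "j \<in> {0..4}"
  shows "vertex n w j \<in> vicsek_set l"
proof (rule vicsek_setI)
  have sub: "vicsek_vertices l m \<subseteq> cells m" for m
    unfolding vertices_eq cells_def using vertex_in_cell by blast
  have v: "vertex n w j \<in> vicsek_vertices l n" using assms unfolding vertices_eq by blast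
  fix m
  have "vertex n w j \<in> vicsek_vertices l (max n m)"
    using v lift_Suc_mono_le[of "vicsek_vertices l", OF vertices_Suc, of n "max n m"] by auto
  then show "vertex n w j \<in> cells m" using sub cells_mono[of m "max n m"] by auto
qed

lemma inverse_L_tendsto: "(\<lambda>n. 1 / L n) \<longlonglongrightarrow> 0"
proof (rule tendsto_sandwich[of "\<lambda>_. 0" _ _ "\<lambda>n. (1 / 3) ^ n"])
  show "eventually (\<lambda>n. 1 / L n \<le> (1 / 3) ^ n) sequentially"
    using L_ge by (auto intro!: always_eventually simp: power_one_over frac_le)
qed (auto intro!: always_eventually LIMSEQ_realpow_zero simp: less_imp_le)

text \<open>Shared corners have more than one code, so this map is many-to-one. For sequences over
  \<open>S\<close> the limit exists, since the centres stay in nested cells of radius at most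
  \<open>1 / L n\<close>.\<close>

definition point :: "(nat \<Rightarrow> complex) \<Rightarrow> complex" where
  "point w = lim (\<lambda>n. centre n w)"

lemma centre_tendsto:
  assumes w: "w \<in> space \<Omega>"
  shows "(\<lambda>n. centre n w) \<longlonglongrightarrow> point w"
proof -
  have c: "centre m w \<in> cell n w" if "n \<le> m" for n m
    using cell_mono[OF that, of w] centre_in_cell[of m w] w by (auto simp: space_\<Omega>)
  have "Cauchy (\<lambda>n. centre n w)"
  proof (rule metric_CauchyI)
    fix e :: real assume "0 < e"
    then have "eventually (\<lambda>n. 1 / L n < e / 2) sequentially"
      by (intro order_tendstoD(2)[OF inverse_L_tendsto]) simp
    then obtain n where n: "1 / L n < e / 2" by (auto simp: eventually_sequentially)
    have "dist (centre m w) (centre k w) < e" if "m \<ge> n" "k \<ge> n" for m k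
      using dist_triangle3[of "centre m w" "centre k w" "centre n w"]
        dist_cell[OF c[OF that(1)]] dist_cell[OF c[OF that(2)]] n by simp
    then show "\<exists>M. \<forall>m\<ge>M. \<forall>k\<ge>M. dist (centre m w) (centre k w) < e" by blast
  qed
  then show ?thesis unfolding point_def by (simp add: Cauchy_convergent_iff convergent_LIMSEQ_iff)
qed

lemma point_in_cell:
  assumes w: "w \<in> space \<Omega>"
  shows "point w \<in> cell n w"
proof (rule closed_sequentially[OF compact_imp_closed[OF compact_cell]])
  show "(\<lambda>m. centre (m + n) w) \<longlonglongrightarrow> point w"
    by (rule LIMSEQ_ignore_initial_segment[OF centre_tendsto[OF w]])
  show "centre (m + n) w \<in> cell n w" for m
  proof -
    have "cell (m + n) w \<subseteq> cell n w" using w by (intro cell_mono) (auto simp: space_\<Omega>)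
    then show "centre (m + n) w \<in> cell n w" using centre_in_cell by blast
  qed
qed

lemma point_in_vicsek_set:
  assumes w: "w \<in> space \<Omega>"
  shows "point w \<in> vicsek_set l"
proof (rule vicsek_setI)
  fix n
  have "restrict w {0..<n} \<in> words n" using w by (auto simp: words_def space_\<Omega>)
  moreover have "cell n w = cell n (restrict w {0..<n})" by (rule cell_cong) simp
  ultimately show "point w \<in> cells n" using point_in_cell[OF w, of n] unfolding cells_def by blast
qed

lemma point_measurable: "point \<in> \<Omega> \<rightarrow>\<^sub>M restrict_space borel (vicsek_set l)"
proof (rule measurable_restrict_space2)
  show "point \<in> space \<Omega> \<rightarrow> vicsek_set l" using point_in_vicsek_set by blast
  have "(\<lambda>w. centre n w) \<in> borel_measurable \<Omega>" for n
  proof -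
    have "(\<lambda>w. w k / of_real (L k)) \<in> borel_measurable \<Omega>" for k
    proof -
      have "(\<lambda>w. w k) \<in> \<Omega> \<rightarrow>\<^sub>M count_space (S k)"
        unfolding \<Omega>_def by (rule measurable_component_singleton) simp
      moreover have "(\<lambda>s. s / of_real (L k)) \<in> borel_measurable (count_space (S k))" by simp
      ultimately show ?thesis by (rule measurable_compose)
    qed
    then show ?thesis unfolding centre_def by measurable
  qed
  then show "point \<in> borel_measurable \<Omega>"
    unfolding point_def by (rule borel_measurable_lim_metric)
qed

text \<open>Vanishing cell energies equate the values of \<open>u\<close> at the centre and the
  corners of each cell. Walking along an arm through shared corners links every centre to the centre
  one level up, hence to 0; centres are dense and \<open>u\<close> is continuous.\<close>

lemma constant_if_cell_energy_0:
  assumes u: "continuous_on (vicsek_set l) u" and z: "\<And>n w. w \<in> words n \<Longrightarrow> cell_energy u n w = 0"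
  shows "x \<in> vicsek_set l \<Longrightarrow> u x = u 0"
proof -
  have e: "u (vertex n w j) = u (centre n w)" if "w \<in> words n" "j \<in> {1..4}" for n w j
  proof -
    have "L n powr (p - 1) > 0" by simp
    then have "(\<Sum>j\<in>{1..4}. \<bar>u (vertex n w j) - u (centre n w)\<bar> powr p) = 0"
      using z[OF that(1)] unfolding cell_energy_def by simp
    then show ?thesis using that(2) by (subst (asm) sum_nonneg_eq_0_iff) auto
  qed
  have c: "u (centre n w) = u 0" if "w \<in> words n" for n w
    using that
  proof (induction n arbitrary: w)
    case (Suc n)
    have "w n \<in> S n" using Suc.prems by (auto simp: words_def PiE_iff)
    then obtain m j where w: "w n = of_real (2 * real m / real (l (Suc n))) * vicsek_pt j" "m \<le> half n" "j \<in> {1..4}"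
      unfolding S_eq by blast
    define v where "v m = w(n := of_real (2 * real m / real (l (Suc n))) * vicsek_pt j)" for m
    have v: "v m \<in> words (Suc n)" if "m \<le> half n" for m
      using Suc.prems S_memI[OF that w(3)] unfolding v_def by (auto simp: words_def PiE_iff extensional_def)
    have "u (centre (Suc n) (v m)) = u (centre n w)" if "m \<le> half n" for m
      using that
    proof (induction m)
      case 0
      have "centre (Suc n) (v 0) = centre n w"
        unfolding v_def by (simp only: centre_Suc centre_upd fun_upd_same) simp
      then show ?case by simp
    next
      case (Suc m)
      have "vertex (Suc n) (v m) j = vertex (Suc n) (v (Suc m)) (opposite j)"
        unfolding vertex_def opposite(2)[OF w(3)] by (simp add: v_def centre_Suc L_Suc add_divide_distrib distrib_right)
      then have "u (centre (Suc n) (v (Suc m))) = u (centre (Suc n) (v m))"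
        using e[OF v w(3), of m] e[OF v opposite(1)[OF w(3)], of "Suc m"] Suc.prems by simp
      then show ?case using Suc by simp
    qed
    moreover have "v m = w" unfolding v_def using w(1) by auto
    moreover have "centre n w = centre n (restrict w {0..<n})" by (rule centre_cong) simp
    ultimately show ?case using Suc.IH[OF words_Suc_restrict[OF Suc.prems]] w(2) by metis
  qed simp
  assume x: "x \<in> vicsek_set l"
  have "\<exists>w\<in>words n. dist (centre n w) x \<le> 1 / L n" for n
    using x vicsek_set_subset[of n] dist_cell unfolding cells_def by blast
  then obtain w where w: "\<And>n. w n \<in> words n" "\<And>n. dist (centre n (w n)) x \<le> 1 / L n" by metis
  have "(\<lambda>n. dist (centre n (w n)) x) \<longlonglongrightarrow> 0"
    by (rule tendsto_sandwich[OF _ _ tendsto_const inverse_L_tendsto])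
      (use w(2) in \<open>auto intro: always_eventually\<close>)
  then have lim: "(\<lambda>n. centre n (w n)) \<longlonglongrightarrow> x" by (rule tendsto_dist_iff[THEN iffD2])
  have "centre n (w n) \<in> vicsek_set l" for n using vertex_in_vicsek_set[OF w(1), of 0 n] by simp
  then have "(\<lambda>n. u (centre n (w n))) \<longlonglongrightarrow> u x"
    using continuous_on_tendsto_compose[OF u lim x] by simp
  then show "u x = u 0" unfolding c[OF w(1)] by (simp add: LIMSEQ_const_iff)
qed

section \<open>Energy measures\<close>

text \<open>The hypothesis concerns only words over \<open>S\<close> that extend \<open>w\<close>,
  so estimates valid inside the single cell of \<open>w\<close> can be fed in.\<close>

lemma refine_le:
  assumes "\<And>k v. n \<le> k \<Longrightarrow> (\<And>i. i < n \<Longrightarrow> v i = w i) \<Longrightarrow> (\<And>i. i < k \<Longrightarrow> v i \<in> S i) \<Longrightarrow> g k v \<le> h k v"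
    and "\<And>i. i < n \<Longrightarrow> w i \<in> S i"
  shows "refine g m n w \<le> refine h m n w"
  using assms
proof (induction m arbitrary: n w)
  case 0
  have "g n w \<le> h n w" by (rule 0(1)) (use 0(2) in auto)
  then show ?case by simp
next
  case (Suc m)
  have "refine g m (Suc n) (w(n := s)) \<le> refine h m (Suc n) (w(n := s))" if s: "s \<in> S n" for s
  proof (rule Suc.IH)
    fix k v assume k: "Suc n \<le> k" and v: "\<And>i. i < Suc n \<Longrightarrow> v i = (w(n := s)) i" "\<And>i. i < k \<Longrightarrow> v i \<in> S i"
    have "v i = w i" if "i < n" for i using v(1)[of i] that by simp
    then show "g k v \<le> h k v" using k v(2) by (intro Suc.prems(1)) auto
  next
    fix i assume "i < Suc n"
    then show "(w(n := s)) i \<in> S i" using Suc.prems(2)[of i] s by (cases "i = n") auto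
  qed
  then show ?case by (simp add: sum_mono)
qed

lemma refine_linear:
  "refine (\<lambda>n w. a * g n w + b * h n w) m n w = a * refine g m n w + b * refine h m n w"
  by (induction m arbitrary: n w) (simp_all add: sum.distrib sum_distrib_left)

text \<open>The factor \<open>c\<close> on the left allows lower bounds for the energy of a
  composition, with \<open>u\<close> on the left and the composition on the right.\<close>

lemma local_energy_le:
  assumes le: "\<And>k v. n \<le> k \<Longrightarrow> (\<And>i. i < n \<Longrightarrow> v i = w i) \<Longrightarrow> (\<And>i. i < k \<Longrightarrow> v i \<in> S i) \<Longrightarrow>
      c * cell_energy u k v \<le> a * cell_energy u1 k v + b * cell_energy u2 k v"
    and w: "\<And>i. i < n \<Longrightarrow> w i \<in> S i"
    and nonneg: "0 \<le> a" "0 \<le> b" "0 \<le> c"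
  shows "ennreal c * local_energy u n w \<le> ennreal a * local_energy u1 n w + ennreal b * local_energy u2 n w"
proof -
  have nn: "0 \<le> refine (cell_energy v) m n w" for v m by (rule refine_nonneg) (rule cell_energy_nonneg)
  have "ennreal c * local_energy u n w = (SUP m. ennreal c * ennreal (refine (cell_energy u) m n w))"
    unfolding local_energy_def by (rule SUP_mult_left_ennreal)
  also have "\<dots> \<le> ennreal a * local_energy u1 n w + ennreal b * local_energy u2 n w"
  proof (rule SUP_least)
    fix m
    \<comment> \<open>The summand with factor 0 brings the left side into the form that
      \<open>refine_linear\<close> expands.\<close>
    have "refine (\<lambda>n w. c * cell_energy u n w + 0 * cell_energy u n w) m n w
        \<le> refine (\<lambda>n w. a * cell_energy u1 n w + b * cell_energy u2 n w) m n w"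
      using le by (intro refine_le w) auto
    then have "c * refine (cell_energy u) m n w \<le> a * refine (cell_energy u1) m n w + b * refine (cell_energy u2) m n w"
      unfolding refine_linear by simp
    then have "ennreal (c * refine (cell_energy u) m n w) \<le> ennreal (a * refine (cell_energy u1) m n w + b * refine (cell_energy u2) m n w)"
      by (rule ennreal_leI)
    then have "ennreal c * ennreal (refine (cell_energy u) m n w)
        \<le> ennreal a * ennreal (refine (cell_energy u1) m n w) + ennreal b * ennreal (refine (cell_energy u2) m n w)"
      using nonneg nn by (simp add: ennreal_mult)
    also have "\<dots> \<le> ennreal a * local_energy u1 n w + ennreal b * local_energy u2 n w"
      unfolding local_energy_def by (intro add_mono mult_left_mono SUP_upper) auto
    finally show "ennreal c * ennreal (refine (cell_energy u) m n w)
        \<le> ennreal a * local_energy u1 n w + ennreal b * local_energy u2 n w" .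
  qed
  finally show ?thesis .
qed

lemma vertex_in_K:
  assumes "\<And>i. i < k \<Longrightarrow> v i \<in> S i" "j \<in> {0..4}"
  shows "vertex k v j \<in> vicsek_set l"
proof -
  have "vertex k v j = vertex k (restrict v {0..<k}) j"
    unfolding vertex_def using centre_cong[of k v "restrict v {0..<k}"] by simp
  moreover have "restrict v {0..<k} \<in> words k" using assms(1) by (auto simp: words_def)
  ultimately show ?thesis using vertex_in_vicsek_set assms(2) by simp
qed

lemma centre_in_K: "(\<And>i. i < k \<Longrightarrow> v i \<in> S i) \<Longrightarrow> centre k v \<in> vicsek_set l"
  using vertex_in_K[of k v 0] by simp

text \<open>The energy of a cell is linear in the pth powers of the increments, and both ends of
  each edge lie in \<open>vicsek_set l\<close> and in the cell of \<open>v\<close>, so a pointwise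
  estimate on that cell is enough.\<close>

lemma cell_energy_le:
  assumes "\<And>i. i < k \<Longrightarrow> v i \<in> S i" "0 \<le> c"
    and "\<And>x y. x \<in> vicsek_set l \<inter> cell k v \<Longrightarrow> y \<in> vicsek_set l \<inter> cell k v \<Longrightarrow>
      c * \<bar>u x - u y\<bar> powr p \<le> a * \<bar>u1 x - u1 y\<bar> powr p + b * \<bar>u2 x - u2 y\<bar> powr p"
  shows "c * cell_energy u k v \<le> a * cell_energy u1 k v + b * cell_energy u2 k v"
proof -
  have "c * (\<Sum>j\<in>{1..4}. \<bar>u (vertex k v j) - u (centre k v)\<bar> powr p)
      \<le> (\<Sum>j\<in>{1..4}. a * \<bar>u1 (vertex k v j) - u1 (centre k v)\<bar> powr p + b * \<bar>u2 (vertex k v j) - u2 (centre k v)\<bar> powr p)"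
    unfolding sum_distrib_left
    by (intro sum_mono assms(3)) (auto intro!: vertex_in_K centre_in_K vertex_in_cell centre_in_cell assms(1))
  then have "L k powr (p - 1) * (c * (\<Sum>j\<in>{1..4}. \<bar>u (vertex k v j) - u (centre k v)\<bar> powr p))
      \<le> L k powr (p - 1) * (a * (\<Sum>j\<in>{1..4}. \<bar>u1 (vertex k v j) - u1 (centre k v)\<bar> powr p)
        + b * (\<Sum>j\<in>{1..4}. \<bar>u2 (vertex k v j) - u2 (centre k v)\<bar> powr p))"
    by (intro mult_left_mono) (simp_all add: sum.distrib sum_distrib_left)
  then show ?thesis unfolding cell_energy_def by (simp add: algebra_simps)
qed

lemma energy_n_bdd_above:
  assumes "u1 \<in> energy_dom l p" "u2 \<in> energy_dom l p" "0 \<le> a" "0 \<le> b"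
    and le: "\<And>x y. x \<in> vicsek_set l \<Longrightarrow> y \<in> vicsek_set l \<Longrightarrow>
      \<bar>u x - u y\<bar> powr p \<le> a * \<bar>u1 x - u1 y\<bar> powr p + b * \<bar>u2 x - u2 y\<bar> powr p"
  shows "bdd_above (range (\<lambda>n. energy_n l p n u))"
proof -
  obtain c1 c2 where c: "\<And>n. energy_n l p n u1 \<le> c1" "\<And>n. energy_n l p n u2 \<le> c2"
    using assms(1,2) unfolding energy_dom_def bdd_above_def by auto
  have "energy_n l p n u \<le> a * c1 + b * c2" for n
  proof -
    have "1 * cell_energy u n w \<le> a * cell_energy u1 n w + b * cell_energy u2 n w" if "w \<in> words n" for w
      using that le by (intro cell_energy_le) (auto simp: words_def PiE_iff)
    then have "energy_n l p n u \<le> a * energy_n l p n u1 + b * energy_n l p n u2"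
      unfolding energy_n_eq sum_distrib_left sum.distrib[symmetric] by (intro sum_mono) auto
    also have "\<dots> \<le> a * c1 + b * c2" using c assms by (intro add_mono mult_left_mono) auto
    finally show ?thesis .
  qed
  then show ?thesis by (intro bdd_aboveI[of _ "a * c1 + b * c2"]) auto
qed

text \<open>For \<open>u\<close> in the domain such a measure exists by
  \<open>mass_extension\<close> and is unique by \<open>eq_if_cyl_eq\<close>; the uniqueness is what
  makes the chain rule an identity of measures.\<close>

definition path_measure :: "(complex \<Rightarrow> real) \<Rightarrow> (nat \<Rightarrow> complex) measure" where
  "path_measure u = (SOME M. sets M = sets \<Omega> \<and> finite_measure M \<and>
     (\<forall>n. \<forall>w\<in>space \<Omega>. emeasure M (cyl n w) = local_energy u n w))"

definition \<Gamma> :: "(complex \<Rightarrow> real) \<Rightarrow> complex measure" where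
  "\<Gamma> u = distr (path_measure u) (restrict_space borel (vicsek_set l)) point"

lemma path_measure:
  assumes "u \<in> energy_dom l p"
  shows "sets (path_measure u) = sets \<Omega>" "finite_measure (path_measure u)"
    "w \<in> space \<Omega> \<Longrightarrow> emeasure (path_measure u) (cyl n w) = local_energy u n w"
proof -
  have "mass (local_energy u)" using assms by (intro mass_local_energy) (simp add: energy_dom_def)
  from someI_ex[OF mass_extension[OF this]]
  show "sets (path_measure u) = sets \<Omega>" "finite_measure (path_measure u)"
    "w \<in> space \<Omega> \<Longrightarrow> emeasure (path_measure u) (cyl n w) = local_energy u n w"
    unfolding path_measure_def by blast+
qed

lemma point_measurable_path:
  assumes "u \<in> energy_dom l p"
  shows "point \<in> path_measure u \<rightarrow>\<^sub>M restrict_space borel (vicsek_set l)"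
  using point_measurable measurable_cong_sets[OF path_measure(1)[OF assms] refl] by blast

lemma sets_\<Gamma> [simp]: "sets (\<Gamma> u) = sets (restrict_space borel (vicsek_set l))"
  by (simp add: \<Gamma>_def)

lemma space_\<Gamma> [simp]: "space (\<Gamma> u) = vicsek_set l"
  by (simp add: \<Gamma>_def space_restrict_space)

lemma finite_\<Gamma>: "u \<in> energy_dom l p \<Longrightarrow> finite_measure (\<Gamma> u)"
  unfolding \<Gamma>_def by (intro finite_measure.finite_measure_distr path_measure point_measurable_path)

lemma emeasure_\<Gamma>:
  assumes u: "u \<in> energy_dom l p"
  shows "emeasure (\<Gamma> u) (vicsek_set l) = ennreal (energy l p u)"
proof -
  obtain w where w: "w \<in> space \<Omega>" using space_\<Omega>_ne by blast
  have sp: "space (path_measure u) = space \<Omega>" using path_measure(1)[OF u] by (rule sets_eq_imp_space_eq)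
  have "vicsek_set l \<in> sets (restrict_space borel (vicsek_set l))"
    using sets.top[of "restrict_space borel (vicsek_set l)"] by (simp add: space_restrict_space)
  then have "emeasure (\<Gamma> u) (vicsek_set l) = emeasure (path_measure u) (point -` vicsek_set l \<inter> space \<Omega>)"
    unfolding \<Gamma>_def using point_measurable_path[OF u] by (subst emeasure_distr) (simp_all add: sp)
  also have "point -` vicsek_set l \<inter> space \<Omega> = cyl 0 w" using point_in_vicsek_set by auto
  also have "emeasure (path_measure u) (cyl 0 w) = ennreal (energy l p u)"
    unfolding path_measure(3)[OF u w] using u by (intro local_energy_root) (simp add: energy_dom_def)
  finally show ?thesis .
qed

lemma energy_n_le_energy: "u \<in> energy_dom l p \<Longrightarrow> energy_n l p n u \<le> energy l p u"
  unfolding energy_def energy_dom_def by (intro cSUP_upper) auto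

lemma energy_n_nonneg: "0 \<le> energy_n l p n u"
  by (simp add: energy_n_eq cell_energy_nonneg sum_nonneg)

lemma \<Gamma>_eq_null_iff:
  assumes u: "u \<in> energy_dom l p"
  shows "\<Gamma> u = null_measure (restrict_space borel (vicsek_set l)) \<longleftrightarrow> u constant_on vicsek_set l"
proof
  assume "\<Gamma> u = null_measure (restrict_space borel (vicsek_set l))"
  then have "ennreal (energy l p u) = 0" using emeasure_\<Gamma>[OF u] by simp
  then have "energy l p u \<le> 0" by (simp add: ennreal_eq_0_iff)
  then have "energy_n l p n u = 0" for n
    using energy_n_le_energy[OF u, of n] energy_n_nonneg[of n u] by linarith
  then have "cell_energy u n w = 0" if "w \<in> words n" for n w
    using that sum_nonneg_eq_0_iff[OF finite_words, of n "cell_energy u n"]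
    by (simp add: energy_n_eq cell_energy_nonneg)
  then have "u x = u 0" if "x \<in> vicsek_set l" for x
    using that u by (intro constant_if_cell_energy_0) (auto simp: energy_dom_def C_fun_def)
  then show "u constant_on vicsek_set l" unfolding constant_on_def by blast
next
  assume "u constant_on vicsek_set l"
  then obtain c where c: "\<And>x. x \<in> vicsek_set l \<Longrightarrow> u x = c" unfolding constant_on_def by blast
  have "cell_energy u n w = 0" if "w \<in> words n" for n w
  proof -
    have w: "\<And>i. i < n \<Longrightarrow> w i \<in> S i" using that by (auto simp: words_def PiE_iff)
    have "u (vertex n w j) = c" if "j \<in> {0..4}" for j using c[OF vertex_in_K[OF w that]] .
    from this[of 0] this show ?thesis using p by (simp add: cell_energy_def)
  qed
  then have "energy l p u = 0" unfolding energy_def energy_n_eq by simp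
  then have z: "emeasure (\<Gamma> u) (vicsek_set l) = 0" using emeasure_\<Gamma>[OF u] by simp
  show "\<Gamma> u = null_measure (restrict_space borel (vicsek_set l))"
  proof (rule measure_eqI)
    fix A assume "A \<in> sets (\<Gamma> u)"
    then have "emeasure (\<Gamma> u) A \<le> emeasure (\<Gamma> u) (space (\<Gamma> u))" by (intro emeasure_space)
    then show "emeasure (\<Gamma> u) A = emeasure (null_measure (restrict_space borel (vicsek_set l))) A"
      using z by simp
  qed simp
qed

section \<open>Triangle inequality for energy measures\<close>

lemma energy_dom_add:
  assumes u: "u1 \<in> energy_dom l p" "u2 \<in> energy_dom l p"
  shows "restrict (\<lambda>x. u1 x + u2 x) (vicsek_set l) \<in> energy_dom l p" (is "?u \<in> _")
proof -
  have "\<bar>?u x - ?u y\<bar> powr p \<le> (1/2) powr (1 - p) * \<bar>u1 x - u1 y\<bar> powr p + (1 - 1/2) powr (1 - p) * \<bar>u2 x - u2 y\<bar> powr p"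
    if "x \<in> vicsek_set l" "y \<in> vicsek_set l" for x y
    using that powr_abs_add_le[OF p, of "1/2" "u1 x - u1 y" "u2 x - u2 y"] by (simp add: algebra_simps)
  then have "bdd_above (range (\<lambda>n. energy_n l p n ?u))"
    by (intro energy_n_bdd_above[OF u, of "(1/2) powr (1 - p)" "(1 - 1/2) powr (1 - p)"]) auto
  moreover have "?u \<in> C_fun (vicsek_set l)"
  proof -
    have "continuous_on (vicsek_set l) (\<lambda>x. u1 x + u2 x)"
      using u by (intro continuous_on_add) (auto simp: energy_dom_def C_fun_def)
    then have "continuous_on (vicsek_set l) ?u" by (rule continuous_on_eq) simp
    then show ?thesis by (simp add: C_fun_def)
  qed
  ultimately show ?thesis by (simp add: energy_dom_def)
qed

lemma nn_integral_\<Gamma>_add: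
  assumes u: "u1 \<in> energy_dom l p" "u2 \<in> energy_dom l p" and t: "0 < t" "t < 1"
    and g: "g \<in> borel_measurable (restrict_space borel (vicsek_set l))"
  shows "(\<integral>\<^sup>+x. g x \<partial>\<Gamma> (restrict (\<lambda>x. u1 x + u2 x) (vicsek_set l)))
    \<le> ennreal (t powr (1 - p)) * (\<integral>\<^sup>+x. g x \<partial>\<Gamma> u1) + ennreal ((1 - t) powr (1 - p)) * (\<integral>\<^sup>+x. g x \<partial>\<Gamma> u2)"
proof -
  let ?u = "restrict (\<lambda>x. u1 x + u2 x) (vicsek_set l)"
  have uu: "?u \<in> energy_dom l p" by (rule energy_dom_add[OF u])
  have le: "ennreal 1 * local_energy ?u n w
      \<le> ennreal (t powr (1 - p)) * local_energy u1 n w + ennreal ((1 - t) powr (1 - p)) * local_energy u2 n w"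
    if "w \<in> space \<Omega>" for n w
  proof (rule local_energy_le)
    fix k v assume v: "\<And>i. i < k \<Longrightarrow> v i \<in> S i"
    show "1 * cell_energy ?u k v \<le> t powr (1 - p) * cell_energy u1 k v + (1 - t) powr (1 - p) * cell_energy u2 k v"
    proof (rule cell_energy_le[OF v])
      fix x y assume "x \<in> vicsek_set l \<inter> cell k v" "y \<in> vicsek_set l \<inter> cell k v"
      then show "1 * \<bar>?u x - ?u y\<bar> powr p \<le> t powr (1 - p) * \<bar>u1 x - u1 y\<bar> powr p + (1 - t) powr (1 - p) * \<bar>u2 x - u2 y\<bar> powr p"
        using powr_abs_add_le[OF p t, of "u1 x - u1 y" "u2 x - u2 y"] by (simp add: algebra_simps)
    qed auto
  qed (use that in \<open>auto simp: space_\<Omega>\<close>)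
  have int: "(\<integral>\<^sup>+x. g x \<partial>\<Gamma> v) = (\<integral>\<^sup>+w. g (point w) \<partial>path_measure v)" if "v \<in> energy_dom l p" for v
    unfolding \<Gamma>_def using point_measurable_path[OF that] g by (simp add: nn_integral_distr)
  show ?thesis
    unfolding int[OF uu] int[OF u(1)] int[OF u(2)]
    by (rule nn_integral_le_if_cyl_le)
      (use le path_measure uu u measurable_compose[OF point_measurable g] in \<open>auto simp: less_top\<close>)
qed

lemma \<Gamma>_add:
  assumes u: "u1 \<in> energy_dom l p" "u2 \<in> energy_dom l p"
    and g: "g \<in> borel_measurable (restrict_space borel (vicsek_set l))"
  shows "ennreal_powr (\<integral>\<^sup>+x. g x \<partial>\<Gamma> (restrict (\<lambda>x. u1 x + u2 x) (vicsek_set l))) (1 / p)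
    \<le> ennreal_powr (\<integral>\<^sup>+x. g x \<partial>\<Gamma> u1) (1 / p) + ennreal_powr (\<integral>\<^sup>+x. g x \<partial>\<Gamma> u2) (1 / p)"
proof -
  define I where "I = (\<integral>\<^sup>+x. g x \<partial>\<Gamma> (restrict (\<lambda>x. u1 x + u2 x) (vicsek_set l)))"
  define A where "A = (\<integral>\<^sup>+x. g x \<partial>\<Gamma> u1)"
  define B where "B = (\<integral>\<^sup>+x. g x \<partial>\<Gamma> u2)"
  have le: "I \<le> ennreal (t powr (1 - p)) * A + ennreal ((1 - t) powr (1 - p)) * B" if "0 < t" "t < 1" for t
    unfolding I_def A_def B_def by (rule nn_integral_\<Gamma>_add[OF u that g])
  show ?thesis
  proof (cases "A = \<infinity> \<or> B = \<infinity>")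
    case True
    then show ?thesis by (auto simp: A_def[symmetric] B_def[symmetric] ennreal_powr_def)
  next
    case False
    then obtain x y where x: "A = ennreal x" "0 \<le> x" and y: "B = ennreal y" "0 \<le> y"
      by (metis ennreal_cases infinity_ennreal_def)
    have le': "I \<le> ennreal (t powr (1 - p) * x + (1 - t) powr (1 - p) * y)" if "0 < t" "t < 1" for t
      using le[OF that] x y by (simp add: ennreal_mult)
    \<comment> \<open>Any admissible t shows that the left integral is finite.\<close>
    obtain i where i: "I = ennreal i" "0 \<le> i"
      using le'[of "1/2"] by (cases I rule: ennreal_cases) (auto simp: top_unique)
    define a where "a = x powr (1 / p)"
    define b where "b = y powr (1 / p)"
    have ab: "a \<ge> 0" "b \<ge> 0" "a powr p = x" "b powr p = y"
      using p x y by (auto simp: a_def b_def powr_powr)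
    have "i powr (1 / p) \<le> a + b"
    proof (rule field_le_epsilon)
      fix e :: real assume e: "0 < e"
      \<comment> \<open>The shift by \<open>e / 2\<close> makes both numbers positive, so that t
        lies strictly between 0 and 1 even if one of the integrals vanishes.\<close>
      define a' where "a' = a + e / 2"
      define b' where "b' = b + e / 2"
      \<comment> \<open>The minimiser of \<open>t powr (1 - p) * a' powr p + (1 - t) powr (1 - p) *
        b' powr p\<close>, where \<open>a' / t = b' / (1 - t)\<close>; the minimum is
        \<open>(a' + b') powr p\<close>.\<close>
      define t where "t = a' / (a' + b')"
      have pos: "a' > 0" "b' > 0" using ab e by (auto simp: a'_def b'_def)
      have t: "0 < t" "t < 1" "1 - t = b' / (a' + b')" using pos by (auto simp: t_def field_simps)
      have trm: "(c / d) powr (1 - p) * c powr p = c * d powr (p - 1)" if "c > 0" "d > 0" for c d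
        using that by (simp add: powr_divide powr_diff field_simps)
      have "i \<le> t powr (1 - p) * x + (1 - t) powr (1 - p) * y"
        using le'[OF t(1,2)] x(2) y(2) unfolding i(1) by (subst (asm) ennreal_le_iff) simp_all
      also have "\<dots> \<le> t powr (1 - p) * a' powr p + (1 - t) powr (1 - p) * b' powr p"
        unfolding ab(3,4)[symmetric] using ab(1,2) e p
        by (intro add_mono mult_left_mono powr_mono2) (auto simp: a'_def b'_def)
      also have "\<dots> = (a' + b') * (a' + b') powr (p - 1)"
        unfolding t(3) unfolding t_def using trm[OF pos(1), of "a' + b'"] trm[OF pos(2), of "a' + b'"] pos
        by (simp add: distrib_right)
      also have "\<dots> = (a' + b') powr p"
        using pos by (simp add: powr_diff)
      finally have "i powr (1 / p) \<le> ((a' + b') powr p) powr (1 / p)"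
        using i p by (intro powr_mono2) auto
      also have "\<dots> = a + b + e" using pos p by (simp add: powr_powr a'_def b'_def)
      finally show "i powr (1 / p) \<le> a + b + e" .
    qed
    then show ?thesis
      unfolding I_def[symmetric] A_def[symmetric] B_def[symmetric] i(1) x(1) y(1) ennreal_powr_def
      using i x y ab by (simp add: a_def[symmetric] b_def[symmetric] ennreal_plus[symmetric] ennreal_leI del: ennreal_plus)
  qed
qed

section \<open>Chain rule\<close>

lemma bounded_range:
  assumes "u \<in> energy_dom l p"
  obtains R where "\<And>x. x \<in> vicsek_set l \<Longrightarrow> u x \<in> {-R..R}"
proof -
  have "compact (u ` vicsek_set l)"
    using assms by (intro compact_continuous_image compact_vicsek_set) (auto simp: energy_dom_def C_fun_def)
  then obtain R where "\<forall>y\<in>u ` vicsek_set l. norm y \<le> R" using compact_imp_bounded bounded_iff by blast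
  then show ?thesis by (intro that[of R]) (auto simp: abs_le_iff)
qed

text \<open>The range of \<open>u\<close> is bounded, so f is Lipschitz on an interval containing
  it, and the increments of the composition are dominated by those of \<open>u\<close>.\<close>

lemma energy_dom_compose:
  assumes u: "u \<in> energy_dom l p" and f: "f C1_differentiable_on UNIV"
  shows "restrict (f \<circ> u) (vicsek_set l) \<in> energy_dom l p" (is "?v \<in> _")
proof -
  note D = C1_deriv[OF f]
  obtain R where R: "\<And>x. x \<in> vicsek_set l \<Longrightarrow> u x \<in> {-R..R}" using bounded_range[OF u] by blast
  have "compact (deriv f ` {-R..R})"
    by (intro compact_continuous_image continuous_on_subset[OF D(2)]) auto
  then obtain C where C: "\<And>z. z \<in> {-R..R} \<Longrightarrow> \<bar>deriv f z\<bar> \<le> C"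
    using compact_imp_bounded bounded_iff by (metis (no_types, lifting) image_eqI real_norm_def)
  have "\<bar>?v x - ?v y\<bar> powr p \<le> (C powr p) * \<bar>u x - u y\<bar> powr p + 0 * \<bar>u x - u y\<bar> powr p"
    if xy: "x \<in> vicsek_set l" "y \<in> vicsek_set l" for x y
  proof -
    obtain z where z: "z \<in> closed_segment (u x) (u y)" "\<bar>f (u x) - f (u y)\<bar> = \<bar>deriv f z\<bar> * \<bar>u x - u y\<bar>"
      using mvt_between[of f "deriv f", OF D(1)] by blast
    have "z \<in> {-R..R}" using z(1) R[OF xy(1)] R[OF xy(2)] by (auto simp: closed_segment_eq_real_ivl split: if_splits)
    then have "\<bar>deriv f z\<bar> powr p \<le> C powr p" using C p by (intro powr_mono2) auto
    then have "\<bar>deriv f z\<bar> powr p * \<bar>u x - u y\<bar> powr p \<le> C powr p * \<bar>u x - u y\<bar> powr p"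
      by (rule mult_right_mono) simp
    moreover have "?v x = f (u x)" "?v y = f (u y)" using xy by simp_all
    ultimately show ?thesis by (simp only: z(2) powr_mult abs_ge_zero)
  qed
  then have "bdd_above (range (\<lambda>n. energy_n l p n ?v))"
    by (intro energy_n_bdd_above[OF u u, of "C powr p" 0]) auto
  moreover have "?v \<in> C_fun (vicsek_set l)"
  proof -
    have "continuous_on UNIV f" using D(1) by (intro continuous_at_imp_continuous_on ballI DERIV_isCont)
    then have "continuous_on (vicsek_set l) (\<lambda>x. f (u x))"
      by (rule continuous_on_compose2) (use u in \<open>auto simp: energy_dom_def C_fun_def\<close>)
    then have "continuous_on (vicsek_set l) ?v" by (rule continuous_on_eq) simp
    then show ?thesis by (simp add: C_fun_def)
  qed
  ultimately show ?thesis by (simp add: energy_dom_def)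
qed

text \<open>Here z stands for a mean value point, known only to lie between two values of
  \<open>u\<close> on the cell. Uniform continuity of \<phi> on an interval containing the range of
  \<open>u\<close> covers all such points.\<close>

lemma small_oscillation:
  assumes u: "u \<in> energy_dom l p" and \<phi>: "continuous_on UNIV (\<phi> :: real \<Rightarrow> real)" and e: "0 < e"
  obtains N where "\<And>n w x y z a. N \<le> n \<Longrightarrow> x \<in> vicsek_set l \<inter> cell n w \<Longrightarrow> y \<in> vicsek_set l \<inter> cell n w \<Longrightarrow>
    a \<in> vicsek_set l \<inter> cell n w \<Longrightarrow> z \<in> closed_segment (u x) (u y) \<Longrightarrow> \<bar>\<phi> z - \<phi> (u a)\<bar> \<le> e"
proof -
  obtain R where R: "\<And>x. x \<in> vicsek_set l \<Longrightarrow> u x \<in> {-R..R}" using bounded_range[OF u] by blast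
  have "uniformly_continuous_on {-R..R} \<phi>"
    by (intro compact_uniformly_continuous continuous_on_subset[OF \<phi>]) auto
  then obtain d where d: "d > 0" "\<And>x y. x \<in> {-R..R} \<Longrightarrow> y \<in> {-R..R} \<Longrightarrow> \<bar>x - y\<bar> < d \<Longrightarrow> \<bar>\<phi> x - \<phi> y\<bar> < e"
    using e unfolding uniformly_continuous_on_def dist_real_def by metis
  have "uniformly_continuous_on (vicsek_set l) u"
    using u by (intro compact_uniformly_continuous compact_vicsek_set) (auto simp: energy_dom_def C_fun_def)
  then obtain r where r: "r > 0" "\<And>x y. x \<in> vicsek_set l \<Longrightarrow> y \<in> vicsek_set l \<Longrightarrow> dist x y < r \<Longrightarrow> \<bar>u x - u y\<bar> < d"
    using d(1) unfolding uniformly_continuous_on_def dist_real_def by metis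
  have "eventually (\<lambda>n. 1 / L n < r / 2) sequentially"
    using r(1) by (intro order_tendstoD(2)[OF inverse_L_tendsto]) simp
  then obtain N where N: "\<And>n. N \<le> n \<Longrightarrow> 1 / L n < r / 2" by (auto simp: eventually_sequentially)
  show ?thesis
  proof (rule that[of N])
    fix n w x y z a
    assume n: "N \<le> n" and x: "x \<in> vicsek_set l \<inter> cell n w" and y: "y \<in> vicsek_set l \<inter> cell n w"
      and a: "a \<in> vicsek_set l \<inter> cell n w" and z: "z \<in> closed_segment (u x) (u y)"
    have close: "\<bar>u b - u a\<bar> < d" if b: "b \<in> vicsek_set l \<inter> cell n w" for b
    proof -
      have "dist b a < r"
        using dist_triangle3[of b a "centre n w"] dist_cell[of b n w] dist_cell[of a n w] a b N[OF n] by simp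
      then show ?thesis using r(2) a b by blast
    qed
    have "\<bar>z - u a\<bar> < d"
      using z close[OF x] close[OF y] by (auto simp: closed_segment_eq_real_ivl split: if_splits)
    moreover have "z \<in> {-R..R}"
      using z R[of x] R[of y] x y by (auto simp: closed_segment_eq_real_ivl split: if_splits)
    moreover have "u a \<in> {-R..R}" using R a by blast
    ultimately show "\<bar>\<phi> z - \<phi> (u a)\<bar> \<le> e" using d(2) by (simp add: less_imp_le)
  qed
qed

text \<open>On a small cell the density is nearly a constant \<open>T\<close>, so the energy of the
  composition and the weighted measure are both close to \<open>T\<close> times the energy of
  \<open>u\<close>; \<open>T\<close> is then eliminated between the two.\<close>

lemma path_measure_chain:
  assumes u: "u \<in> energy_dom l p" and f: "f C1_differentiable_on UNIV"
  shows "path_measure (restrict (f \<circ> u) (vicsek_set l))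
    = density (path_measure u) (\<lambda>w. ennreal (\<bar>deriv f (u (point w))\<bar> powr p))"
proof -
  note D = C1_deriv[OF f]
  define v where "v = restrict (f \<circ> u) (vicsek_set l)"
  define \<phi> where "\<phi> x = \<bar>deriv f x\<bar> powr p" for x
  define M where "M = path_measure u"
  define N where "N = density M (\<lambda>w. ennreal (\<phi> (u (point w))))"
  have v: "v \<in> energy_dom l p" unfolding v_def by (rule energy_dom_compose[OF u f])
  have \<phi>: "continuous_on UNIV \<phi>"
    unfolding \<phi>_def using D(2) p by (intro continuous_on_powr' continuous_intros) auto
  have \<phi>0: "0 \<le> \<phi> x" for x by (simp add: \<phi>_def)
  have u_meas: "u \<in> borel_measurable (restrict_space borel (vicsek_set l))"
    using u by (intro borel_measurable_continuous_on_restrict) (auto simp: energy_dom_def C_fun_def)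
  have setsM: "sets M = sets \<Omega>" unfolding M_def by (rule path_measure[OF u])
  have setsN: "sets N = sets \<Omega>" by (simp add: N_def setsM)
  have spM: "space M = space \<Omega>" using setsM by (rule sets_eq_imp_space_eq)
  have finM: "finite_measure M" unfolding M_def by (rule path_measure[OF u])
  have meas: "(\<lambda>w. ennreal (\<phi> (u (point w)))) \<in> borel_measurable M"
  proof -
    have "(\<lambda>w. u (point w)) \<in> borel_measurable M"
      unfolding M_def by (rule measurable_compose[OF point_measurable_path[OF u] u_meas])
    then have "(\<lambda>w. \<phi> (u (point w))) \<in> borel_measurable M"
      by (rule measurable_compose) (rule borel_measurable_continuous_onI[OF \<phi>])
    then show ?thesis by simp
  qed
  have finN: "finite_measure N"
  proof
    obtain R where R: "\<And>x. x \<in> vicsek_set l \<Longrightarrow> u x \<in> {-R..R}" using bounded_range[OF u] by blast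
    have "compact (\<phi> ` {-R..R})" by (intro compact_continuous_image continuous_on_subset[OF \<phi>]) auto
    then obtain C where C: "\<And>z. z \<in> {-R..R} \<Longrightarrow> \<phi> z \<le> C"
      using compact_imp_bounded bounded_iff by (metis (no_types, lifting) abs_le_iff image_eqI real_norm_def)
    have "emeasure N (space N) = (\<integral>\<^sup>+x. ennreal (\<phi> (u (point x))) * indicator (space M) x \<partial>M)"
      unfolding N_def using meas by (simp add: emeasure_density)
    also have "\<dots> \<le> (\<integral>\<^sup>+x. ennreal C * indicator (space M) x \<partial>M)"
    proof (intro nn_integral_mono)
      fix x assume "x \<in> space M"
      then have "\<phi> (u (point x)) \<le> C" using C R point_in_vicsek_set by (simp add: spM)
      then show "ennreal (\<phi> (u (point x))) * indicator (space M) x \<le> ennreal C * indicator (space M) x"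
        by (intro mult_right_mono ennreal_leI) auto
    qed
    also have "\<dots> = ennreal C * emeasure M (space M)" by (intro nn_integral_cmult_indicator) simp
    also have "\<dots> < \<infinity>" using finite_measure.emeasure_finite[OF finM] by (simp add: ennreal_mult_less_top less_top)
    finally show "emeasure N (space N) \<noteq> \<infinity>" by simp
  qed
  \<comment> \<open>The error is a multiple of \<open>emeasure M (cyl n w)\<close> and hence itself
    additive. An estimate proved on small cylinders can therefore be summed up to larger ones, on
    which the density may oscillate strongly.\<close>
  have estimate: "emeasure N (cyl n w) \<le> local_energy v n w + ennreal (2 * e) * emeasure M (cyl n w)
      \<and> local_energy v n w \<le> emeasure N (cyl n w) + ennreal (2 * e) * emeasure M (cyl n w)"
    if e: "0 < e" and w: "w \<in> space \<Omega>" for e n w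
  proof -
    obtain N0 where N0: "\<And>n w x y z a. N0 \<le> n \<Longrightarrow> x \<in> vicsek_set l \<inter> cell n w \<Longrightarrow> y \<in> vicsek_set l \<inter> cell n w \<Longrightarrow>
        a \<in> vicsek_set l \<inter> cell n w \<Longrightarrow> z \<in> closed_segment (u x) (u y) \<Longrightarrow> \<bar>\<phi> z - \<phi> (u a)\<bar> \<le> e"
      using small_oscillation[OF u \<phi> e] by blast
    have fine: "emeasure N (cyl n w) \<le> local_energy v n w + ennreal (2 * e) * emeasure M (cyl n w)
        \<and> local_energy v n w \<le> emeasure N (cyl n w) + ennreal (2 * e) * emeasure M (cyl n w)"
      if n: "N0 \<le> n" and w: "w \<in> space \<Omega>" for n w
    proof -
      \<comment> \<open>The density frozen at one coded point of the cylinder. The error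
        \<open>2 * e\<close> collects one e from comparing the composition with \<open>T\<close> and
        one from comparing \<open>N\<close> with \<open>T\<close>.\<close>
      define T where "T = \<phi> (u (point w))"
      have T: "0 \<le> T" by (simp add: T_def \<phi>0)
      have pw: "point w' \<in> vicsek_set l \<inter> cell n w" if "w' \<in> cyl n w" for w'
      proof -
        have "w' \<in> space \<Omega>" using that by (simp add: cyl_def)
        moreover have "cell n w' = cell n w" by (rule cell_cong) (use that in \<open>auto simp: cyl_def\<close>)
        ultimately show ?thesis using point_in_cell point_in_vicsek_set by blast
      qed
      have ww: "w \<in> cyl n w" using w by (simp add: cyl_def)
      have edge: "\<exists>z. \<bar>v x - v y\<bar> powr p = \<phi> z * \<bar>u x - u y\<bar> powr p \<and> \<bar>\<phi> z - T\<bar> \<le> e"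
        if x: "x \<in> vicsek_set l \<inter> cell n w" and y: "y \<in> vicsek_set l \<inter> cell n w" for x y
      proof -
        obtain z where z: "z \<in> closed_segment (u x) (u y)" "\<bar>f (u x) - f (u y)\<bar> = \<bar>deriv f z\<bar> * \<bar>u x - u y\<bar>"
          using mvt_between[of f "deriv f", OF D(1)] by blast
        have "\<bar>v x - v y\<bar> powr p = \<phi> z * \<bar>u x - u y\<bar> powr p"
          using x y z(2) by (simp add: v_def \<phi>_def powr_mult)
        then show ?thesis using N0[OF n x y pw[OF ww] z(1)] unfolding T_def by blast
      qed
      have sub: "cell k w' \<subseteq> cell n w" if "n \<le> k" "\<And>i. i < n \<Longrightarrow> w' i = w i" "\<And>i. i < k \<Longrightarrow> w' i \<in> S i" for k w'
        using cell_mono[OF that(1,3)] cell_cong[OF that(2)] by simp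
      have up: "ennreal 1 * local_energy v n w \<le> ennreal (T + e) * local_energy u n w + ennreal 0 * local_energy u n w"
      proof (rule local_energy_le)
        fix k w' assume h: "n \<le> k" "\<And>i. i < n \<Longrightarrow> w' i = w i" "\<And>i. i < k \<Longrightarrow> w' i \<in> S i"
        show "1 * cell_energy v k w' \<le> (T + e) * cell_energy u k w' + 0 * cell_energy u k w'"
        proof (rule cell_energy_le[OF h(3)])
          fix x y assume "x \<in> vicsek_set l \<inter> cell k w'" "y \<in> vicsek_set l \<inter> cell k w'"
          then obtain z where z: "\<bar>v x - v y\<bar> powr p = \<phi> z * \<bar>u x - u y\<bar> powr p" "\<bar>\<phi> z - T\<bar> \<le> e"
            using edge sub[OF h] by blast
          then show "1 * \<bar>v x - v y\<bar> powr p \<le> (T + e) * \<bar>u x - u y\<bar> powr p + 0 * \<bar>u x - u y\<bar> powr p"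
            by (simp add: mult_right_mono)
        qed auto
      qed (use w T e in \<open>auto simp: space_\<Omega>\<close>)
      \<comment> \<open>The error stands on the right because \<open>T - e\<close> may be negative,
        which extended nonnegative reals would truncate.\<close>
      have lo: "ennreal T * local_energy u n w \<le> ennreal 1 * local_energy v n w + ennreal e * local_energy u n w"
      proof (rule local_energy_le)
        fix k w' assume h: "n \<le> k" "\<And>i. i < n \<Longrightarrow> w' i = w i" "\<And>i. i < k \<Longrightarrow> w' i \<in> S i"
        show "T * cell_energy u k w' \<le> 1 * cell_energy v k w' + e * cell_energy u k w'"
        proof (rule cell_energy_le[OF h(3)])
          fix x y assume "x \<in> vicsek_set l \<inter> cell k w'" "y \<in> vicsek_set l \<inter> cell k w'"
          then obtain z where z: "\<bar>v x - v y\<bar> powr p = \<phi> z * \<bar>u x - u y\<bar> powr p" "\<bar>\<phi> z - T\<bar> \<le> e"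
            using edge sub[OF h] by blast
          have "T * \<bar>u x - u y\<bar> powr p \<le> (\<phi> z + e) * \<bar>u x - u y\<bar> powr p"
            using z(2) by (intro mult_right_mono) auto
          then show "T * \<bar>u x - u y\<bar> powr p \<le> 1 * \<bar>v x - v y\<bar> powr p + e * \<bar>u x - u y\<bar> powr p"
            by (simp add: z(1) distrib_right)
        qed (use T in auto)
      qed (use w T e in \<open>auto simp: space_\<Omega>\<close>)
      have Mu: "local_energy u n w = emeasure M (cyl n w)" unfolding M_def by (simp add: path_measure(3)[OF u w])
      have Ncyl: "emeasure N (cyl n w) = (\<integral>\<^sup>+x. ennreal (\<phi> (u (point x))) * indicator (cyl n w) x \<partial>M)"
        unfolding N_def using meas by (intro emeasure_density) (simp_all add: setsM)
      have osc: "\<bar>\<phi> (u (point w')) - T\<bar> \<le> e" if "w' \<in> cyl n w" for w'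
        using N0[OF n pw[OF ww] pw[OF ww] pw[OF that], of "u (point w)"] by (simp add: T_def abs_minus_commute)
      have Nup: "emeasure N (cyl n w) \<le> ennreal (T + e) * emeasure M (cyl n w)"
      proof -
        have "emeasure N (cyl n w) \<le> (\<integral>\<^sup>+x. ennreal (T + e) * indicator (cyl n w) x \<partial>M)"
          unfolding Ncyl
        proof (intro nn_integral_mono)
          fix x show "ennreal (\<phi> (u (point x))) * indicator (cyl n w) x \<le> ennreal (T + e) * indicator (cyl n w) x"
            using osc[of x] by (auto simp: indicator_def intro!: ennreal_leI)
        qed
        also have "\<dots> = ennreal (T + e) * emeasure M (cyl n w)"
          by (intro nn_integral_cmult_indicator) (simp add: setsM)
        finally show ?thesis .
      qed
      have Nlo: "ennreal T * emeasure M (cyl n w) \<le> emeasure N (cyl n w) + ennreal e * emeasure M (cyl n w)"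
      proof -
        have "ennreal T * emeasure M (cyl n w) = (\<integral>\<^sup>+x. ennreal T * indicator (cyl n w) x \<partial>M)"
          by (intro nn_integral_cmult_indicator[symmetric]) (simp add: setsM)
        also have "\<dots> \<le> (\<integral>\<^sup>+x. ennreal (\<phi> (u (point x))) * indicator (cyl n w) x + ennreal e * indicator (cyl n w) x \<partial>M)"
        proof (intro nn_integral_mono)
          fix x
          show "ennreal T * indicator (cyl n w) x \<le> ennreal (\<phi> (u (point x))) * indicator (cyl n w) x + ennreal e * indicator (cyl n w) x"
            using osc[of x] e \<phi>0 by (auto simp: indicator_def ennreal_plus[symmetric] simp del: ennreal_plus intro!: ennreal_leI)
        qed
        also have "\<dots> = emeasure N (cyl n w) + ennreal e * emeasure M (cyl n w)"
        proof -
          have [measurable]: "cyl n w \<in> sets M" by (simp add: setsM)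
          note meas [measurable]
          show ?thesis unfolding Ncyl by (subst nn_integral_add) (auto simp: nn_integral_cmult_indicator)
        qed
        finally show ?thesis .
      qed
      have split: "ennreal (T + e) * c = ennreal T * c + ennreal e * c" "ennreal (2 * e) * c = ennreal e * c + ennreal e * c" for c
        using T e by (simp_all add: distrib_right[symmetric] ennreal_plus[symmetric] del: ennreal_plus)
      have a1: "local_energy v n w \<le> ennreal T * emeasure M (cyl n w) + ennreal e * emeasure M (cyl n w)"
        using up unfolding split by (simp add: Mu)
      have a2: "ennreal T * emeasure M (cyl n w) \<le> local_energy v n w + ennreal e * emeasure M (cyl n w)"
        using lo by (simp add: Mu)
      show ?thesis
      proof
        show "emeasure N (cyl n w) \<le> local_energy v n w + ennreal (2 * e) * emeasure M (cyl n w)"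
          using order_trans[OF Nup[unfolded split] add_right_mono[OF a2]] unfolding split(2) by (simp add: add.assoc)
        show "local_energy v n w \<le> emeasure N (cyl n w) + ennreal (2 * e) * emeasure M (cyl n w)"
          using order_trans[OF a1 add_right_mono[OF Nlo]] unfolding split(2) by (simp add: add.assoc)
      qed
    qed
    have mv: "mass (local_energy v)" using v by (intro mass_local_energy) (simp add: energy_dom_def)
    have mN: "mass (\<lambda>n w. emeasure N (cyl n w))" by (intro mass_measure setsN finN)
    have mM: "mass (\<lambda>n w. ennreal (2 * e) * emeasure M (cyl n w))"
      by (intro mass_cmult mass_measure setsM finM) simp
    show ?thesis
      using mass_le_if_eventually[OF mN mass_add[OF mv mM], of N0] mass_le_if_eventually[OF mv mass_add[OF mN mM], of N0]
        fine w by blast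
  qed
  have eq: "emeasure N (cyl n w) = local_energy v n w" if w: "w \<in> space \<Omega>" for n w
  proof -
    define c where "c = measure M (cyl n w)"
    have c: "emeasure M (cyl n w) = ennreal c" "0 \<le> c"
      unfolding c_def using finM by (simp_all add: finite_measure.emeasure_eq_measure)
    \<comment> \<open>The tolerance is scaled so that the error on this cylinder is at most e;
      \<open>c + 1\<close> keeps the denominator positive when the cylinder has mass 0.\<close>
    have small: "ennreal (2 * (e / (2 * (c + 1)))) * ennreal c \<le> ennreal e" if "0 < e" for e
    proof -
      have "2 * (e / (2 * (c + 1))) * c \<le> e" using c(2) that by (simp add: field_simps)
      then show ?thesis using c(2) that by (simp add: ennreal_mult[symmetric] ennreal_leI)
    qed
    have pos: "0 < e / (2 * (c + 1))" if "0 < e" for e using that c(2) by simp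
    show ?thesis
    proof (rule antisym)
      show "emeasure N (cyl n w) \<le> local_energy v n w"
      proof (rule ennreal_le_epsilon)
        fix e :: real assume "0 < e"
        then show "emeasure N (cyl n w) \<le> local_energy v n w + ennreal e"
          using estimate[OF pos w, of e n] small[of e] unfolding c by (meson add_left_mono order_trans)
      qed
      show "local_energy v n w \<le> emeasure N (cyl n w)"
      proof (rule ennreal_le_epsilon)
        fix e :: real assume "0 < e"
        then show "local_energy v n w \<le> emeasure N (cyl n w) + ennreal e"
          using estimate[OF pos w, of e n] small[of e] unfolding c by (meson add_left_mono order_trans)
      qed
    qed
  qed
  have "path_measure v = N"
    using path_measure[OF v] finN setsN eq by (intro eq_if_cyl_eq) auto
  then show ?thesis by (simp add: v_def N_def M_def \<phi>_def)
qed

text \<open>The density depends on a word only through its point, so it can be moved through the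
  image measure.\<close>

lemma \<Gamma>_chain:
  assumes u: "u \<in> energy_dom l p" and f: "f C1_differentiable_on UNIV"
  shows "\<Gamma> (restrict (f \<circ> u) (vicsek_set l)) = density (\<Gamma> u) (\<lambda>x. ennreal (\<bar>deriv f (u x)\<bar> powr p))"
proof -
  have u_meas: "u \<in> borel_measurable (restrict_space borel (vicsek_set l))"
    using u by (intro borel_measurable_continuous_on_restrict) (auto simp: energy_dom_def C_fun_def)
  have [measurable]: "deriv f \<in> borel_measurable borel"
    using C1_deriv(2)[OF f] by (rule borel_measurable_continuous_onI)
  have "(\<lambda>x. ennreal (\<bar>deriv f (u x)\<bar> powr p)) \<in> borel_measurable (restrict_space borel (vicsek_set l))"
    using u_meas by measurable
  then show ?thesis
    unfolding \<Gamma>_def path_measure_chain[OF u f]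
    using point_measurable_path[OF u] by (intro density_distr[symmetric])
qed

section \<open>Energy image density\<close>

text \<open>The chain rule integrated over the whole set and transported to the line: energies of
  compositions become integrals against the image measure alone.\<close>

lemma emeasure_image_\<Gamma>:
  assumes u: "u \<in> energy_dom l p" and h: "h C1_differentiable_on UNIV"
  shows "ennreal (energy l p (restrict (h \<circ> u) (vicsek_set l))) = (\<integral>\<^sup>+y. ennreal (\<bar>deriv h y\<bar> powr p) \<partial>distr (\<Gamma> u) borel u)"
proof -
  have u_meas: "u \<in> borel_measurable (\<Gamma> u)"
    using u borel_measurable_continuous_on_restrict[of "vicsek_set l" u]
    by (simp add: energy_dom_def C_fun_def cong: measurable_cong_sets)
  have [measurable]: "deriv h \<in> borel_measurable borel"
    using C1_deriv(2)[OF h] by (rule borel_measurable_continuous_onI)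
  note u_meas [measurable]
  have m: "(\<lambda>x. ennreal (\<bar>deriv h (u x)\<bar> powr p)) \<in> borel_measurable (\<Gamma> u)" by measurable
  have "ennreal (energy l p (restrict (h \<circ> u) (vicsek_set l))) = emeasure (\<Gamma> (restrict (h \<circ> u) (vicsek_set l))) (vicsek_set l)"
    by (rule emeasure_\<Gamma>[OF energy_dom_compose[OF u h], symmetric])
  also have "\<dots> = (\<integral>\<^sup>+x. ennreal (\<bar>deriv h (u x)\<bar> powr p) * indicator (space (\<Gamma> u)) x \<partial>\<Gamma> u)"
    unfolding \<Gamma>_chain[OF u h] using emeasure_density[OF m sets.top] by simp
  also have "\<dots> = (\<integral>\<^sup>+x. ennreal (\<bar>deriv h (u x)\<bar> powr p) \<partial>\<Gamma> u)"
    by (rule nn_integral_cong) simp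
  also have "\<dots> = (\<integral>\<^sup>+y. ennreal (\<bar>deriv h y\<bar> powr p) \<partial>distr (\<Gamma> u) borel u)"
    by (simp add: nn_integral_distr)
  finally show ?thesis .
qed

text \<open>The energy of a fixed level involves finitely many vertices, so it converges under
  pointwise convergence and inherits the bound, which then passes to the supremum over
  levels.\<close>

lemma energy_lsc:
  assumes v: "\<And>m. m \<ge> N \<Longrightarrow> v m \<in> energy_dom l p" "\<And>m. m \<ge> N \<Longrightarrow> energy l p (v m) \<le> c"
    and lim: "\<And>x. x \<in> vicsek_set l \<Longrightarrow> (\<lambda>m. v m x) \<longlonglongrightarrow> u x"
  shows "energy l p u \<le> c"
  unfolding energy_def
proof (rule cSUP_least)
  fix n
  have "(\<lambda>m. \<Sum>w\<in>words n. cell_energy (v m) n w) \<longlonglongrightarrow> (\<Sum>w\<in>words n. cell_energy u n w)"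
  proof (rule tendsto_sum)
    fix w assume "w \<in> words n"
    then have w: "\<And>i. i < n \<Longrightarrow> w i \<in> S i" by (auto simp: words_def PiE_iff)
    have "(\<lambda>m. v m (vertex n w j)) \<longlonglongrightarrow> u (vertex n w j)" if "j \<in> {0..4}" for j
      by (rule lim[OF vertex_in_K[OF w that]])
    from this[of 0] this show "(\<lambda>m. cell_energy (v m) n w) \<longlonglongrightarrow> cell_energy u n w"
      unfolding cell_energy_def using p
      by (intro tendsto_mult_left tendsto_sum tendsto_powr' tendsto_rabs tendsto_diff tendsto_const) auto
  qed
  moreover have "\<forall>\<^sub>F m in sequentially. (\<Sum>w\<in>words n. cell_energy (v m) n w) \<le> c"
    using order_trans[OF energy_n_le_energy[OF v(1)] v(2)]
    by (auto simp: energy_n_eq eventually_sequentially)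
  ultimately show "energy_n l p n u \<le> c"
    unfolding energy_n_eq by (rule tendsto_upperbound) simp
qed simp

text \<open>The distance to the empty set is 0 by convention; nonemptiness of \<open>A\<close>
  ensures that the cutoffs vanish away from \<open>A\<close>.\<close>

lemma compact_null_image:
  assumes u: "u \<in> energy_dom l p" and A: "compact A" "A \<noteq> {}" "emeasure lborel A = 0"
  shows "emeasure (distr (\<Gamma> u) borel u) A = 0"
proof -
  define \<nu> where "\<nu> = distr (\<Gamma> u) borel u"
  \<comment> \<open>Cutoffs of width \<open>1 / real (Suc n)\<close> around \<open>A\<close>. For n
    at most m, \<open>\<phi> n - \<phi> m\<close> vanishes on \<open>A\<close>, where both are 1,
    and at distance at least \<open>1 / real (Suc n)\<close>, where both are 0; what remains is
    \<open>B n\<close>.\<close>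
  define \<phi> where "\<phi> n x = max 0 (1 - real (Suc n) * infdist x A)" for n and x :: real
  define B where "B n = {x. 0 < infdist x A \<and> infdist x A < 1 / real (Suc n)}" for n
  have u_meas: "u \<in> borel_measurable (\<Gamma> u)"
    using u borel_measurable_continuous_on_restrict[of "vicsek_set l" u]
    by (simp add: energy_dom_def C_fun_def cong: measurable_cong_sets)
  have fin: "finite_measure \<nu>"
    unfolding \<nu>_def by (rule finite_measure.finite_measure_distr[OF finite_\<Gamma>[OF u] u_meas])
  interpret \<nu>: finite_measure \<nu> by (rule fin)
  have sets: "sets \<nu> = sets borel" by (simp add: \<nu>_def)
  have B_sets: "B n \<in> sets borel" for n
  proof -
    have [measurable]: "(\<lambda>x. infdist x A) \<in> borel_measurable borel"
      by (intro borel_measurable_continuous_onI continuous_intros)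
    show ?thesis unfolding B_def by measurable
  qed
  have cont: "continuous_on UNIV (\<phi> n)" for n
    unfolding \<phi>_def by (intro continuous_intros)
  have clA: "closed A" using A(1) by (rule compact_imp_closed)
  have onA: "\<phi> n x = 1" if "x \<in> A" for n x using that by (simp add: \<phi>_def)
  have offA: "infdist x A > 0" if "x \<notin> A" for x
    using that infdist_pos_not_in_closed[OF clA A(2)] by blast
  have rng: "0 \<le> \<phi> n x" "\<phi> n x \<le> 1" for n x
    using infdist_nonneg[of x A] by (auto simp: \<phi>_def)
  \<comment> \<open>Antiderivatives on the whole line, normalised at 0 so that their values are
    integrals of the cutoffs starting from 0.\<close>
  have "\<exists>F. (\<forall>x. (F has_real_derivative \<phi> n x) (at x)) \<and> F 0 = 0" for n
  proof -
    obtain G where G: "\<And>x. (G has_vector_derivative \<phi> n x) (at x)"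
      using einterval_antiderivative[of "-\<infinity>" \<infinity> "\<phi> n"] cont[of n]
      by (auto simp: continuous_on_eq_continuous_at)
    have "((\<lambda>x. G x - G 0) has_real_derivative \<phi> n x) (at x)" for x
      using G[of x] by (auto simp: has_real_derivative_iff_has_vector_derivative[symmetric] intro!: derivative_eq_intros)
    then show ?thesis by (intro exI[of _ "\<lambda>x. G x - G 0"]) auto
  qed
  then obtain f where f: "\<And>n x. (f n has_real_derivative \<phi> n x) (at x)" "\<And>n. f n 0 = 0" by metis
  have C1: "h C1_differentiable_on UNIV" if "\<And>x. (h has_real_derivative h' x) (at x)" "continuous_on UNIV h'" for h h'
    unfolding C1_differentiable_on_def using that
    by (auto simp: has_real_derivative_iff_has_vector_derivative)
  \<comment> \<open>The cutoffs converge to the indicator of the closed set \<open>A\<close>, whose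
    integral over every interval is 0 because \<open>A\<close> is a null set; the constant 1
    dominates.\<close>
  have f_lim: "(\<lambda>n. f n x) \<longlonglongrightarrow> 0" for x
  proof -
    have null: "negligible A"
      unfolding negligible_iff_null_sets
      using A(3) borel_closed[OF clA] by (intro null_sets_completionI) (simp add: null_sets_def)
    have inc: "(\<lambda>n. f n b - f n a) \<longlonglongrightarrow> 0" if "a \<le> b" for a b
    proof -
      have int: "(\<phi> n has_integral (f n b - f n a)) {a..b}" for n
        using that f(1) by (intro fundamental_theorem_of_calculus)
          (auto simp: has_real_derivative_iff_has_vector_derivative[symmetric] intro: has_field_derivative_at_within)
      have ind: "(indicat_real A has_integral 0) {a..b}"
        using null unfolding negligible_def box_real[symmetric] by blast
      have "(\<lambda>n. integral {a..b} (\<phi> n)) \<longlonglongrightarrow> integral {a..b} (indicat_real A)"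
      proof (rule dominated_convergence(2))
        show "\<phi> n integrable_on {a..b}" for n using int by (rule has_integral_integrable)
        show "(\<lambda>_. 1) integrable_on {a..b}" by (rule integrable_const_ivl)
        show "norm (\<phi> n x) \<le> 1" for n x using rng[of n x] by simp
        show "(\<lambda>n. \<phi> n x) \<longlonglongrightarrow> indicat_real A x" for x
        proof (cases "x \<in> A")
          case False
          obtain N where N: "1 / real (Suc N) < infdist x A"
            using offA[OF False] nat_approx_posE by metis
          have "\<phi> n x = 0" if "n \<ge> N" for n
          proof -
            have "1 \<le> real (Suc N) * infdist x A" using N by (simp add: field_simps)
            also have "\<dots> \<le> real (Suc n) * infdist x A" using that infdist_nonneg by (intro mult_right_mono) auto
            finally show ?thesis by (simp add: \<phi>_def)
          qed
          then have "\<forall>\<^sub>F n in sequentially. \<phi> n x = 0" unfolding eventually_sequentially by blast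
          then show ?thesis using False by (simp add: tendsto_eventually)
        qed (simp add: onA)
      qed
      then show ?thesis using integral_unique[OF int] integral_unique[OF ind] by simp
    qed
    show ?thesis
      using inc[of 0 x] tendsto_minus[OF inc[of x 0]] f(2) by (cases "0 \<le> x") auto
  qed
  \<comment> \<open>The bound depends on n only, so it survives the limit in m.\<close>
  have bound: "energy l p (restrict ((\<lambda>x. f n x - f m x) \<circ> u) (vicsek_set l)) \<le> measure \<nu> (B n)"
    "restrict ((\<lambda>x. f n x - f m x) \<circ> u) (vicsek_set l) \<in> energy_dom l p" if "n \<le> m" for n m
  proof -
    have d: "((\<lambda>x. f n x - f m x) has_real_derivative \<phi> n x - \<phi> m x) (at x)" for x
      using f(1) by (intro derivative_intros)
    have c1: "(\<lambda>x. f n x - f m x) C1_differentiable_on UNIV"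
      by (rule C1[OF d]) (intro continuous_intros cont)
    show "restrict ((\<lambda>x. f n x - f m x) \<circ> u) (vicsek_set l) \<in> energy_dom l p"
      by (rule energy_dom_compose[OF u c1])
    have B: "B n \<in> sets \<nu>" using B_sets by (simp add: sets)
    have "ennreal (energy l p (restrict ((\<lambda>x. f n x - f m x) \<circ> u) (vicsek_set l)))
        = (\<integral>\<^sup>+y. ennreal (\<bar>\<phi> n y - \<phi> m y\<bar> powr p) \<partial>\<nu>)"
      unfolding emeasure_image_\<Gamma>[OF u c1] \<nu>_def using DERIV_imp_deriv[OF d] by simp
    also have "\<dots> \<le> (\<integral>\<^sup>+y. indicator (B n) y \<partial>\<nu>)"
    proof (rule nn_integral_mono)
      fix y
      show "ennreal (\<bar>\<phi> n y - \<phi> m y\<bar> powr p) \<le> indicator (B n) y"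
      proof (cases "y \<in> B n")
        case True
        have "\<bar>\<phi> n y - \<phi> m y\<bar> \<le> 1" using rng[of n y] rng[of m y] by linarith
        then have "\<bar>\<phi> n y - \<phi> m y\<bar> powr p \<le> 1 powr p" using p by (intro powr_mono2) auto
        then show ?thesis using True by simp
      next
        case False
        have "\<phi> n y = \<phi> m y"
        proof (cases "y \<in> A")
          case False
          then have "1 / real (Suc n) \<le> infdist y A" using offA \<open>y \<notin> B n\<close> unfolding B_def by force
          then have "1 \<le> real (Suc n) * infdist y A" by (simp add: field_simps)
          moreover have "real (Suc n) * infdist y A \<le> real (Suc m) * infdist y A"
            using \<open>n \<le> m\<close> infdist_nonneg by (intro mult_right_mono) auto
          ultimately show ?thesis by (simp add: \<phi>_def)
        qed (simp add: onA)
        then show ?thesis using p by simp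
      qed
    qed
    also have "\<dots> = ennreal (measure \<nu> (B n))" using B by (simp add: \<nu>.emeasure_eq_measure)
    finally show "energy l p (restrict ((\<lambda>x. f n x - f m x) \<circ> u) (vicsek_set l)) \<le> measure \<nu> (B n)"
      by (simp add: ennreal_le_iff)
  qed
  have le: "measure \<nu> A \<le> measure \<nu> (B n)" for n
  proof -
    have c1: "f n C1_differentiable_on UNIV" by (rule C1[OF f(1) cont])
    have "energy l p (restrict (f n \<circ> u) (vicsek_set l)) \<le> measure \<nu> (B n)"
    proof (rule energy_lsc)
      show "restrict ((\<lambda>x. f n x - f m x) \<circ> u) (vicsek_set l) \<in> energy_dom l p" if "n \<le> m" for m
        by (rule bound(2)[OF that])
      show "energy l p (restrict ((\<lambda>x. f n x - f m x) \<circ> u) (vicsek_set l)) \<le> measure \<nu> (B n)" if "n \<le> m" for m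
        by (rule bound(1)[OF that])
      show "(\<lambda>m. restrict ((\<lambda>x. f n x - f m x) \<circ> u) (vicsek_set l) x) \<longlonglongrightarrow> restrict (f n \<circ> u) (vicsek_set l) x"
        if "x \<in> vicsek_set l" for x
        using tendsto_diff[OF tendsto_const[of "f n (u x)"] f_lim[of "u x"]] that by simp
    qed
    have "ennreal (measure \<nu> A) = (\<integral>\<^sup>+y. indicator A y \<partial>\<nu>)"
      using borel_closed[OF clA] by (simp add: sets \<nu>.emeasure_eq_measure)
    also have "\<dots> \<le> (\<integral>\<^sup>+y. ennreal (\<bar>deriv (f n) y\<bar> powr p) \<partial>\<nu>)"
      using DERIV_imp_deriv[OF f(1)] onA by (intro nn_integral_mono) (auto simp: indicator_def)
    also have "\<dots> = ennreal (energy l p (restrict (f n \<circ> u) (vicsek_set l)))"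
      unfolding \<nu>_def by (rule emeasure_image_\<Gamma>[OF u c1, symmetric])
    also have "\<dots> \<le> ennreal (measure \<nu> (B n))" by (rule ennreal_leI) fact
    finally show ?thesis by (simp add: ennreal_le_iff)
  qed
  have "(\<lambda>n. measure \<nu> (B n)) \<longlonglongrightarrow> measure \<nu> (\<Inter>n. B n)"
  proof (rule \<nu>.finite_Lim_measure_decseq)
    show "range B \<subseteq> sets \<nu>" using B_sets by (auto simp: sets)
    show "decseq B"
    proof (rule antimonoI)
      fix n m :: nat assume "n \<le> m"
      then have "1 / real (Suc m) \<le> 1 / real (Suc n)" by (simp add: frac_le)
      then show "B m \<le> B n" by (auto simp: B_def)
    qed
  qed
  \<comment> \<open>The strict inequality \<open>0 < infdist x A\<close> removes the points of
    \<open>A\<close>, so nothing is left; without this puncture the intersection would be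
    \<open>A\<close> itself.\<close>
  also have "(\<Inter>n. B n) = {}"
  proof -
    have "x \<notin> (\<Inter>n. B n)" for x
    proof
      assume x: "x \<in> (\<Inter>n. B n)"
      then have "0 < infdist x A" by (auto simp: B_def)
      then obtain n where "1 / real (Suc n) < infdist x A" using nat_approx_posE by metis
      moreover have "infdist x A < 1 / real (Suc n)" using x by (auto simp: B_def)
      ultimately show False by simp
    qed
    then show ?thesis by blast
  qed
  finally have "measure \<nu> A \<le> 0"
    using le by (intro tendsto_lowerbound[of "\<lambda>n. measure \<nu> (B n)" 0 sequentially]) auto
  then show ?thesis by (simp add: \<nu>_def[symmetric] \<nu>.emeasure_eq_measure measure_le_0_iff)
qed

text \<open>Inner regularity of the finite image measure reduces a Borel null set to its compact
  subsets.\<close>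

lemma energy_image_density:
  assumes u: "u \<in> energy_dom l p"
  shows "absolutely_continuous lborel (distr (\<Gamma> u) borel u)"
  unfolding absolutely_continuous_def
proof
  let ?\<nu> = "distr (\<Gamma> u) borel u"
  have u_meas: "u \<in> borel_measurable (\<Gamma> u)"
    using u borel_measurable_continuous_on_restrict[of "vicsek_set l" u]
    by (simp add: energy_dom_def C_fun_def cong: measurable_cong_sets)
  interpret \<nu>: finite_measure ?\<nu>
    by (rule finite_measure.finite_measure_distr[OF finite_\<Gamma>[OF u] u_meas])
  fix A assume A: "A \<in> null_sets (lborel :: real measure)"
  then have bA: "A \<in> sets borel" by auto
  have "emeasure ?\<nu> C = 0" if "C \<subseteq> A" "compact C" for C
  proof (cases "C = {}")
    case False
    have "emeasure lborel C \<le> emeasure lborel A" using that A by (intro emeasure_mono) auto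
    then have "emeasure lborel C = 0" using A by (simp add: null_sets_def)
    then show ?thesis using compact_null_image[OF u that(2) False] by simp
  qed simp
  then have "(SUP C\<in>{C. C \<subseteq> A \<and> compact C}. emeasure ?\<nu> C) \<le> 0"
    by (intro SUP_least) auto
  moreover have "emeasure ?\<nu> A = (SUP C\<in>{C. C \<subseteq> A \<and> compact C}. emeasure ?\<nu> C)"
    using bA \<nu>.emeasure_finite by (intro inner_regular) auto
  ultimately show "A \<in> null_sets ?\<nu>" using bA by (simp add: null_sets_def)
qed

end

theorem theorem1p2:
  fixes l :: "nat \<Rightarrow> nat" and p :: real and \<mu> :: "complex measure" and K :: "complex set"
  assumes l: "scale_sequence l"
    and K: "K = vicsek_set l"
    and \<mu>: "vicsek_measure l \<mu>"
    and p: "1 < p"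
  shows "\<exists>\<Gamma> :: (complex \<Rightarrow> real) \<Rightarrow> complex measure.
    (\<forall>u\<in>energy_dom l p. finite_borel_measure_on K (\<Gamma> u)) \<and>
    (\<forall>u\<in>energy_dom l p.
       emeasure (\<Gamma> u) K = ennreal (energy l p u) \<and>
       (\<Gamma> u = null_measure (restrict_space borel K) \<longleftrightarrow> u constant_on K)) \<and>
    (\<forall>u1\<in>energy_dom l p. \<forall>u2\<in>energy_dom l p.
       \<forall>g :: complex \<Rightarrow> ennreal. g \<in> borel_measurable (restrict_space borel K) \<longrightarrow>
         ennreal_powr (\<integral>\<^sup>+x. g x \<partial>\<Gamma> (restrict (\<lambda>x. u1 x + u2 x) K)) (1 / p)
           \<le> ennreal_powr (\<integral>\<^sup>+x. g x \<partial>\<Gamma> u1) (1 / p) + ennreal_powr (\<integral>\<^sup>+x. g x \<partial>\<Gamma> u2) (1 / p)) \<and>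
    (\<forall>f :: real \<Rightarrow> real. f C1_differentiable_on UNIV \<longrightarrow>
       (\<forall>u\<in>energy_dom l p.
          \<Gamma> (restrict (f \<circ> u) K) = density (\<Gamma> u) (\<lambda>x. ennreal (\<bar>deriv f (u x)\<bar> powr p)))) \<and>
    (\<forall>u\<in>energy_dom l p. absolutely_continuous lborel (distr (\<Gamma> u) borel u))"
proof -
  interpret vicsek l p using l p by unfold_locales
  show ?thesis unfolding K
  proof (intro exI[of _ \<Gamma>] conjI ballI allI impI)
    fix u assume u: "u \<in> energy_dom l p"
    show "finite_borel_measure_on (vicsek_set l) (\<Gamma> u)"
      using finite_\<Gamma>[OF u] by (simp add: finite_borel_measure_on_def)
  qed (simp_all only: emeasure_\<Gamma> \<Gamma>_eq_null_iff \<Gamma>_add \<Gamma>_chain energy_image_density)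
qed

end
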